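(* Let $k\ge1$ and let $A_1,\dots,A_k$ be Hermitian $n\times n$ matrices with zero diagonal. If all roots of $\chi[A_1,\dots,A_k]$ lie in the interval $[\ell,r]$, then for every $j\in\{1,\dots,k\}$ $$\Bigl(A_j-\frac{k(\ell+r)}{2}I\Bigr)^2+\sum_{i\ne j}\operatorname{diag}(A_i^2)\preceq\frac{k^2(r-\ell)^2}{4}I.$$ In particular, if all roots lie in $[-R,R]$, then for every $j\in\{1,\dots,k\}$ $$A_j^2+\sum_{i\ne j}\operatorname{diag}(A_i^2)\preceq k^2R^2I.$$ Equality in the last inequality can hold simultaneously for all $j$: that is, for every $k\ge 1$ there exist zero-diagonal Hermitian matrices $A_1,\dots,A_k$ and a real $R$ such that all roots of $\chi[A_1,\dots,A_k]$ lie in $[-R,R]$ and $A_j^2+\sum_{i\ne j}\operatorname{diag}(A_i^2)=k^2R^2I$ for all $j\in\{1,\dots,k\}$.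
   Context: For a square matrix $B$, $\operatorname{diag}(B)$ denotes the diagonal matrix with the same diagonal as $B$. $A\preceq B$ means $B-A$ is positive semidefinite. For $S\subseteq[n]$, $A[S]$ is the principal submatrix indexed by $S$ (the characteristic polynomial of the empty submatrix is $1$). For Hermitian $n\times n$ matrices $A_1,\dots,A_k$ the normalized mixed determinantal polynomial is $$\chi[A_1,\dots,A_k](x)=k^{-n}\sum_{S_1\sqcup\cdots\sqcup S_k=[n]}\ \prod_{j=1}^k\det(xI-A_j[S_j]),$$ the sum being over ordered partitions of $[n]$ into $k$ possibly empty parts; it is monic of degree $n$ and real-rooted. *)

theory Defs
  imports
    "HOL-Library.FuncSet"
    "HOL-Library.Disjoint_Sets"
    "Jordan_Normal_Form.Char_Poly"
    "Jordan_Normal_Form.Schur_Decomposition"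
    "Jordan_Normal_Form.DL_Submatrix"
begin

definition hermitian_mat :: "nat \<Rightarrow> complex mat \<Rightarrow> bool" where
  "hermitian_mat n A \<longleftrightarrow> A \<in> carrier_mat n n \<and> mat_adjoint A = A"

definition zero_diagonal :: "complex mat \<Rightarrow> bool" where
  "zero_diagonal A \<longleftrightarrow> (\<forall>p < dim_row A. A $$ (p, p) = 0)"

text \<open>Since \<open>u \<bullet>c v\<close> conjugates its second argument, the quadratic form below is
  \<open>v\<^sup>* A v\<close>; it is real for Hermitian \<open>A\<close>.\<close>

definition psd_mat :: "nat \<Rightarrow> complex mat \<Rightarrow> bool" where
  "psd_mat n A \<longleftrightarrow> hermitian_mat n A \<and> (\<forall>v \<in> carrier_vec n. 0 \<le> Re ((A *\<^sub>v v) \<bullet>c v))"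

definition loewner_le :: "nat \<Rightarrow> complex mat \<Rightarrow> complex mat \<Rightarrow> bool" where
  "loewner_le n A B \<longleftrightarrow> A \<in> carrier_mat n n \<and> B \<in> carrier_mat n n \<and> psd_mat n (B - A)"

definition diag_part :: "complex mat \<Rightarrow> complex mat" where
  "diag_part B = mat_diag (dim_row B) (\<lambda>p. B $$ (p, p))"

text \<open>The type of matrices has no zero common to all dimensions, so \<open>sum\<close> does not apply to it;
  the sum of a family of \<open>n \<times> n\<close> matrices is taken entrywise.\<close>

definition mat_sum :: "nat \<Rightarrow> ('i \<Rightarrow> complex mat) \<Rightarrow> 'i set \<Rightarrow> complex mat" where
  "mat_sum n F I = mat n n (\<lambda>(p, q). \<Sum>i\<in>I. F i $$ (p, q))"

text \<open>Matrix indices range over \<open>{..<n}\<close> in place of \<open>[n]\<close>. The extensional function space makes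
  each ordered partition into \<open>k\<close> possibly empty parts occur exactly once.\<close>

definition ordered_partitions :: "nat \<Rightarrow> nat \<Rightarrow> (nat \<Rightarrow> nat set) set" where
  "ordered_partitions k n =
     {S \<in> {1..k} \<rightarrow>\<^sub>E Pow {..<n}. disjoint_family_on S {1..k} \<and> (\<Union>j\<in>{1..k}. S j) = {..<n}}"

definition mixed_det_poly :: "nat \<Rightarrow> nat \<Rightarrow> (nat \<Rightarrow> complex mat) \<Rightarrow> complex poly" where
  "mixed_det_poly k n A =
     smult (1 / of_nat k ^ n)
       (\<Sum>S\<in>ordered_partitions k n. \<Prod>j\<in>{1..k}. char_poly (submatrix (A j) (S j) (S j)))"

text \<open>All complex roots are meant, so every root is in particular required to be real.\<close>

definition all_roots_in :: "complex poly \<Rightarrow> real \<Rightarrow> real \<Rightarrow> bool" where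
  "all_roots_in p l r \<longleftrightarrow> (\<forall>z. poly p z = 0 \<longrightarrow> z \<in> complex_of_real ` {l..r})"

end

(*
  Replacing A_j by A_j - t v v^* changes chi[A_1, ..., A_k] into chi + t eta, which has no zero with
  Im x > 0 and Im t >= 0. Hence eta / chi has non-positive imaginary part in the upper half plane,
  so it is a sum of w_i / (x - mu_i) over the roots mu_i of chi with weights w_i >= 0. The first three
  moments of these weights are v^* v / k, v^* A_j v / k^2 and
  v^* (A_j^2 + sum_{i <> j} diag (A_i^2)) v / k^3, by expanding eta / chi at infinity. If all roots
  lie in [l, r], then sum_i w_i (mu_i - l) (r - mu_i) >= 0, which is the claimed inequality for v,
  divided by k^3.
*)

theory Submission
  imports Defs
begin

section \<open>Principal minors\<close>

text \<open>Here chi is the average, over assignments \<open>s\<close> of indices to parts, of the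
  characteristic polynomials of direct sums B of the A_i[S_i]; under the uniform measure the values
  \<open>s p\<close> are independent. The obstacle is that eta / chi is a quotient of two averages,
  not an average of resolvent entries. With u the part of v in class j, its second moment therefore
  carries, besides the average of u^* B^2 u, the covariance of u^* u with the second coefficient of
  the characteristic polynomial, which is -1/2 tr B^2. The first contribution is A_j^2 plus an
  excess (k - 1) diag (A_j^2), because a closed path p, r, p involves one index fewer than a path
  with three different indices. The covariance contributes - k diag (A_j^2) plus the sum of diag
  (A_i^2) over all i, including j. Together they leave exactly the diagonal squares with i <> j.
  Zero diagonals make every direct sum traceless and remove the terms in which neighbouring indices
  of a path coincide, so that only these two patterns have to be counted.\<close>

definition pminor :: "(nat \<Rightarrow> nat \<Rightarrow> 'a::comm_ring_1) \<Rightarrow> nat set \<Rightarrow> 'a" where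
  "pminor M S = (\<Sum>\<pi> | \<pi> permutes S. of_int (sign \<pi>) * (\<Prod>i\<in>S. M i (\<pi> i)))"

lemma pminor_cong:
  assumes "\<And>p q. p \<in> S \<Longrightarrow> q \<in> S \<Longrightarrow> M p q = N p q"
  shows "pminor M S = pminor N S"
  unfolding pminor_def using assms
  by (intro sum.cong refl arg_cong2[of _ _ _ _ "(*)"] prod.cong) (simp_all add: permutes_in_image)

text \<open>Only permutations fixing \<open>p\<close> meet the entry at \<open>(p, p)\<close>, and
  each meets it once; so a minor is affine in a diagonal entry. This makes every factor in
  \<open>mixed_det_nonzero\<close> linear in the shift \<open>z\<close>.\<close>

lemma pminor_diag_update:
  assumes "finite S" "p \<in> S"
  shows "pminor (\<lambda>a b. M a b + (if a = p \<and> b = p then z else 0)) S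
    = pminor M S + z * pminor M (S - {p})"
proof -
  let ?R = "\<lambda>\<pi>. \<Prod>i\<in>S - {p}. M i (\<pi> i)"
  have split: "(\<Prod>i\<in>S. M i (\<pi> i) + (if i = p \<and> \<pi> i = p then z else 0))
      = (\<Prod>i\<in>S. M i (\<pi> i)) + (if \<pi> p = p then z * ?R \<pi> else 0)" for \<pi>
    using assms by (simp add: prod.remove[of S p] distrib_right)
  have "(\<Sum>\<pi> | \<pi> permutes S. of_int (sign \<pi>) * (if \<pi> p = p then z * ?R \<pi> else 0))
      = (\<Sum>\<pi> | \<pi> permutes S \<and> \<pi> p = p. z * (of_int (sign \<pi>) * ?R \<pi>))"
    using assms(1) finite_permutations[OF assms(1)]
    by (intro sum.mono_neutral_cong_right) auto
  also have "{\<pi>. \<pi> permutes S \<and> \<pi> p = p} = {\<pi>. \<pi> permutes (S - {p})}"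
  proof (intro Collect_cong iffI conjI)
    fix \<pi> assume "\<pi> permutes S \<and> \<pi> p = p"
    then show "\<pi> permutes (S - {p})"
      by (auto intro: permutes_superset)
  next
    fix \<pi> assume *: "\<pi> permutes (S - {p})"
    then show "\<pi> permutes S" by (rule permutes_subset) auto
    show "\<pi> p = p" using * by (simp add: permutes_not_in)
  qed
  finally show ?thesis
    by (simp add: pminor_def split distrib_left sum.distrib sum_distrib_left)
qed

text \<open>Padding with the identity keeps the ambient dimension \<open>n\<close> and the original
  indices, so facts about \<open>det\<close> and kernels apply to a principal minor without
  renumbering \<open>S\<close>.\<close>

definition mask :: "nat \<Rightarrow> (nat \<Rightarrow> nat \<Rightarrow> 'a::comm_ring_1) \<Rightarrow> nat set \<Rightarrow> 'a mat" where
  "mask n M S = mat n n (\<lambda>(p, q). if p \<in> S \<and> q \<in> S then M p q else if p = q then 1 else 0)"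

lemma mask_carrier [simp]: "mask n M S \<in> carrier_mat n n"
  by (simp add: mask_def)

text \<open>A permutation that moves an index outside \<open>S\<close> picks up an off-diagonal zero
  there; the remaining permutations are those of \<open>S\<close>, and the padding contributes
  ones.\<close>

lemma det_mask:
  assumes S: "S \<subseteq> {..<n}"
  shows "det (mask n M S) = pminor M S"
proof -
  have fS: "finite S" using S finite_subset by blast
  let ?f = "\<lambda>\<pi>. of_int (sign \<pi>) * (\<Prod>i = 0..<n. mask n M S $$ (i, \<pi> i))"
  have "det (mask n M S) = (\<Sum>\<pi> | \<pi> permutes {0..<n}. ?f \<pi>)"
    by (rule det_def') simp
  also have "\<dots> = (\<Sum>\<pi> | \<pi> permutes S. ?f \<pi>)"
  proof (rule sum.mono_neutral_right)
    show "{\<pi>. \<pi> permutes S} \<subseteq> {\<pi>. \<pi> permutes {0..<n}}"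
      using S permutes_subset by (fastforce simp: atLeast0LessThan)
    show "\<forall>\<pi>\<in>{\<pi>. \<pi> permutes {0..<n}} - {\<pi>. \<pi> permutes S}. ?f \<pi> = 0"
    proof
      fix \<pi> assume "\<pi> \<in> {\<pi>. \<pi> permutes {0..<n}} - {\<pi>. \<pi> permutes S}"
      then have \<pi>: "\<pi> permutes {0..<n}" and "\<not> \<pi> permutes S" by auto
      then obtain i where i: "i \<in> {0..<n} - S" "\<pi> i \<noteq> i"
        using permutes_superset by blast
      then have "\<pi> i < n" using permutes_in_image[OF \<pi>, of i] by simp
      with i have "mask n M S $$ (i, \<pi> i) = 0" by (auto simp: mask_def)
      then have "(\<Prod>i = 0..<n. mask n M S $$ (i, \<pi> i)) = 0"
        using i by (intro prod_zero) auto
      then show "?f \<pi> = 0" by simp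
    qed
  qed (simp add: finite_permutations)
  also have "\<dots> = pminor M S"
    unfolding pminor_def
  proof (intro sum.cong refl arg_cong2[of _ _ _ _ "(*)"])
    fix \<pi> assume "\<pi> \<in> {\<pi>. \<pi> permutes S}"
    then have \<pi>: "\<pi> permutes S" by simp
    have "(\<Prod>i = 0..<n. mask n M S $$ (i, \<pi> i)) = (\<Prod>i\<in>S. mask n M S $$ (i, \<pi> i))"
      using S \<pi> by (intro prod.mono_neutral_right) (auto simp: mask_def permutes_not_in)
    also have "\<dots> = (\<Prod>i\<in>S. M i (\<pi> i))"
    proof (rule prod.cong)
      fix i assume i: "i \<in> S"
      then have "\<pi> i \<in> S" using permutes_in_image[OF \<pi>, of i] by simp
      moreover have "i < n" "\<pi> i < n" using i S \<open>\<pi> i \<in> S\<close> by auto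
      ultimately show "mask n M S $$ (i, \<pi> i) = M i (\<pi> i)" using i by (simp add: mask_def)
    qed simp
    finally show "(\<Prod>i = 0..<n. mask n M S $$ (i, \<pi> i)) = (\<Prod>i\<in>S. M i (\<pi> i))" .
  qed
  finally show ?thesis .
qed

lemma det_mat_eq_pminor: "det (mat n n (\<lambda>(p, q). M p q)) = pminor M {..<n}"
proof -
  have "mat n n (\<lambda>(p, q). M p q) = mask n M {..<n}"
    by (rule eq_matI) (auto simp: mask_def)
  then show ?thesis by (simp add: det_mask)
qed

lemma pminor_empty [simp]: "pminor M {} = 1"
  by (simp add: pminor_def)

text \<open>For a block-diagonal \<open>N\<close> the padded matrices multiply: the mask of
  \<open>S\<close> is the identity on \<open>T\<close> and conversely. Multiplicativity of
  \<open>det\<close> does the rest.\<close>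

lemma pminor_Un:
  assumes S: "S \<subseteq> {..<n}" and T: "T \<subseteq> {..<n}" and disj: "S \<inter> T = {}"
    and 0: "\<And>p q. p \<in> S \<Longrightarrow> q \<in> T \<Longrightarrow> N p q = 0" "\<And>p q. p \<in> T \<Longrightarrow> q \<in> S \<Longrightarrow> N p q = 0"
  shows "pminor N (S \<union> T) = pminor N S * pminor N T"
proof -
  have "mask n N (S \<union> T) = mask n N S * mask n N T"
  proof (rule eq_matI)
    fix p q assume "p < dim_row (mask n N S * mask n N T)" "q < dim_col (mask n N S * mask n N T)"
    then have pq: "p < n" "q < n" by (auto simp: mask_def)
    let ?m = "\<lambda>S p q. if p \<in> S \<and> q \<in> S then N p q else if p = q then 1 else 0"
    have "(mask n N S * mask n N T) $$ (p, q) = (\<Sum>r\<in>{0..<n}. ?m S p r * ?m T r q)"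
      using pq by (simp add: mask_def scalar_prod_def)
    also have "\<dots> = ?m (S \<union> T) p q"
    proof (cases "p \<in> S")
      case True
      have "?m S p r * ?m T r q = (if r = q then if q \<in> S then N p q else 0 else 0)" for r
        using True disj by auto
      moreover have "?m (S \<union> T) p q = (if q \<in> S then N p q else 0)"
        using True 0(1)[of p q] disj by auto
      ultimately show ?thesis using pq by simp
    next
      case False
      have "?m S p r * ?m T r q = (if r = p then ?m T p q else 0)" for r
        using False by auto
      moreover have "?m (S \<union> T) p q = ?m T p q"
        using False 0(2)[of p q] by auto
      ultimately show ?thesis using pq by simp
    qed
    finally show "mask n N (S \<union> T) $$ (p, q) = (mask n N S * mask n N T) $$ (p, q)"
      using pq by (simp add: mask_def)
  qed (auto simp: mask_def)
  then show ?thesis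
    using S T by (simp add: det_mult[of _ n] flip: det_mask[of _ n])
qed

text \<open>Merges the minors belonging to one partition into a single \<open>n\<close>-dimensional
  determinant, to which resolvent and rank-one formulas apply. The induction adds one fibre at a
  time through \<open>pminor_Un\<close>.\<close>

lemma prod_pminor_fibers:
  assumes "finite K" "s ` {..<n} \<subseteq> K"
  shows "(\<Prod>i\<in>K. pminor (M i) {p\<in>{..<n}. s p = i})
    = pminor (\<lambda>p q. if s p = s q then M (s p) p q else 0) {..<n}" (is "_ = pminor ?N _")
proof -
  have fibers: "(\<Prod>i\<in>L. pminor (M i) {p\<in>{..<n}. s p = i}) = pminor ?N {p\<in>{..<n}. s p \<in> L}"
    if "finite L" for L
    using that
  proof (induction L)
    case (insert i L)
    have eq: "{p\<in>{..<n}. s p \<in> insert i L} = {p\<in>{..<n}. s p = i} \<union> {p\<in>{..<n}. s p \<in> L}"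
      by auto
    have 1: "pminor (M i) {p\<in>{..<n}. s p = i} = pminor ?N {p\<in>{..<n}. s p = i}"
      by (rule pminor_cong) auto
    have 2: "pminor ?N ({p\<in>{..<n}. s p = i} \<union> {p\<in>{..<n}. s p \<in> L})
        = pminor ?N {p\<in>{..<n}. s p = i} * pminor ?N {p\<in>{..<n}. s p \<in> L}"
      using insert.hyps by (intro pminor_Un[of _ n]) auto
    show ?case
      unfolding prod.insert[OF insert.hyps] insert.IH 1 eq 2 ..
  qed simp
  have "{p\<in>{..<n}. s p \<in> K} = {..<n}" using assms(2) by auto
  with fibers[OF assms(1)] show ?thesis by (simp only:)
qed

text \<open>The matrix analogue of the open upper half plane: the Hermitian matrix in the imaginary
  part of \<open>M\<close> is positive definite.\<close>

definition pos_im :: "nat \<Rightarrow> (nat \<Rightarrow> nat \<Rightarrow> complex) \<Rightarrow> bool" where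
  "pos_im n M \<longleftrightarrow> (\<forall>v. (\<exists>p<n. v p \<noteq> 0) \<longrightarrow>
     0 < Im (\<Sum>p<n. \<Sum>q<n. cnj (v p) * M p q * v q))"

text \<open>A kernel vector of the padded matrix vanishes outside \<open>S\<close> and is
  annihilated by the rows of \<open>M\<close> in \<open>S\<close>, so the quadratic form of
  \<open>M\<close> vanishes at it, contrary to \<open>pos_im\<close>.\<close>

lemma pminor_nonzero:
  assumes M: "pos_im n M" and S: "S \<subseteq> {..<n}"
  shows "pminor M S \<noteq> 0"
proof
  assume "pminor M S = 0"
  then have "det (mask n M S) = 0" using S by (simp add: det_mask)
  then obtain v where v: "v \<in> carrier_vec n" "v \<noteq> 0\<^sub>v n" "mask n M S *\<^sub>v v = 0\<^sub>v n"
    using det_0_iff_vec_prod_zero_field[OF mask_carrier] by blast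
  let ?m = "\<lambda>p q. if p \<in> S \<and> q \<in> S then M p q else if p = q then 1 else 0"
  have row: "(\<Sum>q<n. ?m p q * v $ q) = 0" if "p < n" for p
  proof -
    have "(mask n M S *\<^sub>v v) $ p = (\<Sum>q<n. ?m p q * v $ q)"
      using that v(1) by (simp add: mask_def scalar_prod_def atLeast0LessThan)
    then show ?thesis using v(3) that by simp
  qed
  have out: "v $ p = 0" if "p < n" "p \<notin> S" for p
  proof -
    have "(\<Sum>q<n. ?m p q * v $ q) = (\<Sum>q\<in>{p}. v $ q)"
      using that by (intro sum.mono_neutral_cong_right) auto
    then show ?thesis using row[OF that(1)] by simp
  qed
  have ins: "(\<Sum>q<n. M p q * v $ q) = 0" if "p < n" "p \<in> S" for p
  proof -
    have "(\<Sum>q<n. M p q * v $ q) = (\<Sum>q<n. ?m p q * v $ q)"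
      using that out by (intro sum.cong) auto
    then show ?thesis using row[OF that(1)] by simp
  qed
  have "(\<Sum>q<n. cnj (v $ p) * M p q * v $ q) = 0" if "p < n" for p
    using ins[OF that] out[OF that]
    by (cases "p \<in> S") (simp_all add: mult.assoc flip: sum_distrib_left)
  then have "(\<Sum>p<n. \<Sum>q<n. cnj (v $ p) * M p q * v $ q) = 0" by simp
  moreover have "\<exists>p<n. v $ p \<noteq> 0" using v(1,2) by (auto simp: vec_eq_iff)
  ultimately show False using M[unfolded pos_im_def, rule_format, of "($) v"] by simp
qed

section \<open>Stability of mixed determinants\<close>

lemma pos_im_diag_update:
  assumes "pos_im n M" "Im z \<ge> 0"
  shows "pos_im n (\<lambda>a b. M a b + (if a = p \<and> b = p then z else 0))"
  unfolding pos_im_def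
proof (intro allI impI)
  fix v :: "nat \<Rightarrow> complex" assume v: "\<exists>p<n. v p \<noteq> 0"
  have "(\<Sum>a<n. \<Sum>b<n. cnj (v a) * (M a b + (if a = p \<and> b = p then z else 0)) * v b)
    = (\<Sum>a<n. \<Sum>b<n. cnj (v a) * M a b * v b)
      + (\<Sum>a<n. \<Sum>b<n. if b = p then if a = p then cnj (v p) * z * v p else 0 else 0)"
    unfolding sum.distrib[symmetric]
    by (intro sum.cong refl) (auto simp: algebra_simps)
  also have "(\<Sum>a<n. \<Sum>b<n. if b = p then if a = p then cnj (v p) * z * v p else 0 else 0)
      = (if p < n then z * (v p * cnj (v p)) else 0)"
    by (auto simp: mult_ac)
  also have "v p * cnj (v p) = complex_of_real ((cmod (v p))\<^sup>2)"
    by (rule complex_norm_square[symmetric])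
  finally show "0 < Im (\<Sum>a<n. \<Sum>b<n. cnj (v a) * (M a b + (if a = p \<and> b = p then z else 0)) * v b)"
    using assms v unfolding pos_im_def by (simp add: add_pos_nonneg)
qed

text \<open>The coefficients are taken at \<open>card K\<close> and one below, not relative to the
  degree, because some of the \<open>b i\<close> may be zero.\<close>

lemma coeff_prod_linear:
  fixes a b :: "'i \<Rightarrow> 'a::comm_ring_1"
  assumes "finite K"
  shows "degree (\<Prod>i\<in>K. [:a i, b i:]) \<le> card K"
    and "coeff (\<Prod>i\<in>K. [:a i, b i:]) (card K) = (\<Prod>i\<in>K. b i)"
    and "Suc m = card K \<Longrightarrow> coeff (\<Prod>i\<in>K. [:a i, b i:]) m = (\<Sum>i\<in>K. a i * (\<Prod>l\<in>K - {i}. b l))"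
proof -
  have deg: "degree (\<Prod>i\<in>K. [:a i, b i:]) \<le> card K" if "finite K" for K :: "'i set"
  proof -
    have "degree (\<Prod>i\<in>K. [:a i, b i:]) \<le> (\<Sum>i\<in>K. degree [:a i, b i:])"
      by (rule degree_prod_sum_le[OF that, unfolded o_def])
    also have "\<dots> \<le> (\<Sum>i\<in>K. 1)" by (intro sum_mono) simp
    finally show ?thesis by simp
  qed
  then show "degree (\<Prod>i\<in>K. [:a i, b i:]) \<le> card K" using assms .
  have top: "coeff (\<Prod>i\<in>K. [:a i, b i:]) (card K) = (\<Prod>i\<in>K. b i)" if "finite K" for K :: "'i set"
    using that
  proof (induction K)
    case (insert i K)
    have "coeff (\<Prod>i\<in>K. [:a i, b i:]) (Suc (card K)) = 0"
      using deg[OF insert.hyps(1)] by (intro coeff_eq_0) simp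
    with insert show ?case by simp
  qed simp
  then show "coeff (\<Prod>i\<in>K. [:a i, b i:]) (card K) = (\<Prod>i\<in>K. b i)" using assms .
  show "coeff (\<Prod>i\<in>K. [:a i, b i:]) m = (\<Sum>i\<in>K. a i * (\<Prod>l\<in>K - {i}. b l))" if "Suc m = card K"
    using assms that
  proof (induction K arbitrary: m)
    case (insert j K)
    have m: "m = card K" using insert by simp
    have "(\<Prod>l\<in>insert j K - {i}. b l) = b j * (\<Prod>l\<in>K - {i}. b l)" if "i \<in> K" for i
    proof -
      have "insert j K - {i} = insert j (K - {i})" using insert.hyps that by auto
      then show ?thesis using insert.hyps by simp
    qed
    then have sum: "(\<Sum>i\<in>insert j K. a i * (\<Prod>l\<in>insert j K - {i}. b l))
        = a j * (\<Prod>l\<in>K. b l) + b j * (\<Sum>i\<in>K. a i * (\<Prod>l\<in>K - {i}. b l))"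
      using insert.hyps by (simp add: sum_distrib_left mult_ac)
    show ?case
    proof (cases m)
      case 0
      with m insert.hyps show ?thesis by simp
    next
      case (Suc m')
      then have "coeff (\<Prod>i\<in>K. [:a i, b i:]) m' = (\<Sum>i\<in>K. a i * (\<Prod>l\<in>K - {i}. b l))"
        using m insert.IH by simp
      then show ?thesis
        unfolding sum using Suc insert.hyps top[OF insert.hyps(1)] m by simp
    qed
  qed simp
qed

lemma coeff_prod_list_linear_factors:
  fixes as :: "complex list"
  assumes "as \<noteq> []"
  shows "coeff (\<Prod>a\<leftarrow>as. [:- a, 1:]) (length as - 1) = - sum_list as"
  using assms
proof (induction as)
  case (Cons a as)
  have mon: "coeff (\<Prod>a\<leftarrow>as. [:- a, 1:]) (length as) = 1"
    using degree_linear_factors[of uminus as] monic_prod_list[of "map (\<lambda>a. [:- a, 1:]) as"]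
    by fastforce
  show ?case
  proof (cases "as = []")
    case False
    then obtain m where m: "length as = Suc m" by (cases as) auto
    then show ?thesis using mon Cons.IH False by simp
  qed simp
qed simp

text \<open>By Vieta the coefficient is minus the leading one times the sum of the roots. There is
  at least one root and all of them have negative imaginary part, so the sum is not zero.\<close>

lemma subleading_coeff_nonzero:
  fixes P :: "complex poly"
  assumes deg: "degree P = Suc m" and roots: "\<And>z. Im z \<ge> 0 \<Longrightarrow> poly P z \<noteq> 0"
  shows "coeff P m \<noteq> 0"
proof -
  obtain as where P: "smult (lead_coeff P) (\<Prod>a\<leftarrow>as. [:- a, 1:]) = P" and len: "length as = degree P"
    using fundamental_theorem_algebra_factorized[of P] by blast
  have ne: "as \<noteq> []" using len deg by auto
  have "Im a < 0" if "a \<in> set as" for a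
  proof -
    have "poly (\<Prod>a\<leftarrow>as. [:- a, 1:]) a = 0"
      using that by (auto simp: poly_prod_list prod_list_zero_iff)
    then have "poly P a = 0" by (metis P poly_smult mult_zero_right)
    then show ?thesis using roots[of a] by force
  qed
  then have "Im (sum_list as) < 0" using ne
  proof (induction as)
    case (Cons a as)
    then show ?case by (cases "as = []") (auto intro: add_neg_neg)
  qed simp
  moreover have "coeff P m = lead_coeff P * (- sum_list as)"
    using coeff_prod_list_linear_factors[OF ne] len deg P by (metis coeff_smult diff_Suc_1)
  moreover have "lead_coeff P \<noteq> 0"
    using deg by (metis degree_0 leading_coeff_0_iff nat.distinct(1))
  ultimately show ?thesis by auto
qed

lemma sum_PiE_insert:
  assumes "p \<notin> T"
  shows "(\<Sum>s\<in>insert p T \<rightarrow>\<^sub>E K. f s) = (\<Sum>s\<in>T \<rightarrow>\<^sub>E K. \<Sum>i\<in>K. f (s(p := i)))"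
proof -
  have "(\<Sum>s\<in>insert p T \<rightarrow>\<^sub>E K. f s)
      = (\<Sum>x\<in>(\<lambda>(y, g). g(p := y)) ` (K \<times> (T \<rightarrow>\<^sub>E K)). f x)"
    by (simp add: PiE_insert_eq)
  also have "\<dots> = (\<Sum>(i, s)\<in>K \<times> (T \<rightarrow>\<^sub>E K). f (s(p := i)))"
    by (subst sum.reindex[OF inj_combinator[OF assms]]) (simp add: case_prod_unfold)
  also have "\<dots> = (\<Sum>s\<in>T \<rightarrow>\<^sub>E K. \<Sum>i\<in>K. f (s(p := i)))"
    by (subst sum.swap) (simp add: sum.cartesian_product)
  finally show ?thesis .
qed

text \<open>Adding \<open>z\<close> to the \<open>p\<close>-th diagonal entry of every matrix turns the sum over \<open>T\<close>, with \<open>p\<close> put into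
  all parts at once, into a polynomial in \<open>z\<close> without roots in the closed upper half plane. Its
  subleading coefficient, minus the leading one times the sum of the roots, is the sum over
  \<open>insert p T\<close>.\<close>

lemma mixed_det_nonzero:
  assumes "finite T" "T \<inter> U = {}" "T \<union> U \<subseteq> {..<n}" and K: "finite K" "K \<noteq> {}"
    and "\<And>i. i \<in> K \<Longrightarrow> pos_im n (M i)"
  shows "(\<Sum>s\<in>T \<rightarrow>\<^sub>E K. \<Prod>i\<in>K. pminor (M i) ({p\<in>T. s p = i} \<union> U)) \<noteq> 0"
  using assms(1-3,6)
proof (induction T arbitrary: U M)
  case empty
  then have "pminor (M i) U \<noteq> 0" if "i \<in> K" for i
    using that by (intro pminor_nonzero[of n]) auto
  then show ?case using K by simp
next
  case (insert p T)
  have fin: "finite (T \<rightarrow>\<^sub>E K)" using insert.hyps K by (intro finite_PiE) auto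
  let ?b = "\<lambda>s i. pminor (M i) ({q\<in>T. s q = i} \<union> U)"
  let ?a = "\<lambda>s i. pminor (M i) ({q\<in>T. s q = i} \<union> insert p U)"
  define P where "P = (\<Sum>s\<in>T \<rightarrow>\<^sub>E K. \<Prod>i\<in>K. [:?a s i, ?b s i:])"
  obtain m where m: "card K = Suc m" using K by (metis card_0_eq not0_implies_Suc)
  have lead: "coeff P (Suc m) = (\<Sum>s\<in>T \<rightarrow>\<^sub>E K. \<Prod>i\<in>K. ?b s i)"
    unfolding P_def coeff_sum m[symmetric] by (intro sum.cong refl coeff_prod_linear K)
  \<comment> \<open>The leading coefficient leaves \<open>p\<close> out of all parts and is covered
    by the induction hypothesis with the same \<open>U\<close>. The values of \<open>P\<close> below
    use it with \<open>insert p U\<close> and the shifted matrices, which is why \<open>U\<close>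
    and \<open>M\<close> are arbitrary in the induction.\<close>
  have "coeff P (Suc m) \<noteq> 0"
    unfolding lead using insert.prems by (intro insert.IH) auto
  moreover have "degree P \<le> Suc m"
    unfolding P_def m[symmetric] using fin K by (intro degree_sum_le coeff_prod_linear) auto
  ultimately have deg: "degree P = Suc m"
    by (simp add: le_antisym le_degree)
  have roots: "poly P z \<noteq> 0" if "Im z \<ge> 0" for z
  proof -
    let ?M = "\<lambda>i a b. M i a b + (if a = p \<and> b = p then z else 0)"
    have fin': "finite ({q\<in>T. s q = i} \<union> insert p U)" for s and i
      using insert.prems(2) insert.hyps(1) finite_subset[of U "{..<n}"] by auto
    have eq: "({q\<in>T. s q = i} \<union> U) - {p} = {q\<in>T. s q = i} \<union> U" for s and i
      using insert.hyps(2) insert.prems(1) by auto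
    have "poly P z = (\<Sum>s\<in>T \<rightarrow>\<^sub>E K. \<Prod>i\<in>K. pminor (?M i) ({q\<in>T. s q = i} \<union> insert p U))"
      unfolding P_def poly_sum poly_prod
      by (intro sum.cong refl prod.cong, subst pminor_diag_update[OF fin']) (auto simp: eq)
    also have "\<dots> \<noteq> 0"
      using insert.prems insert.hyps that
      by (intro insert.IH pos_im_diag_update) auto
    finally show ?thesis .
  qed
  have "coeff P m = (\<Sum>s\<in>T \<rightarrow>\<^sub>E K. \<Sum>i\<in>K. ?a s i * (\<Prod>l\<in>K - {i}. ?b s l))"
    unfolding P_def coeff_sum by (intro sum.cong refl coeff_prod_linear K m[symmetric])
  also have "\<dots> = (\<Sum>s\<in>T \<rightarrow>\<^sub>E K. \<Sum>i\<in>K. \<Prod>l\<in>K. pminor (M l) ({q\<in>insert p T. (s(p := i)) q = l} \<union> U))"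
  proof (intro sum.cong refl)
    fix s i assume i: "i \<in> K"
    have 1: "{q\<in>insert p T. (s(p := i)) q = i} \<union> U = {q\<in>T. s q = i} \<union> insert p U"
      using insert.hyps by auto
    have 2: "{q\<in>insert p T. (s(p := i)) q = l} \<union> U = {q\<in>T. s q = l} \<union> U" if "l \<noteq> i" for l
      using insert.hyps that by auto
    show "?a s i * (\<Prod>l\<in>K - {i}. ?b s l)
        = (\<Prod>l\<in>K. pminor (M l) ({q\<in>insert p T. (s(p := i)) q = l} \<union> U))"
      unfolding prod.remove[OF K(1) i] 1
      by (intro arg_cong2[of _ _ _ _ "(*)"] refl prod.cong) (simp add: 2[symmetric])
  qed
  also have "\<dots> = (\<Sum>s\<in>insert p T \<rightarrow>\<^sub>E K. \<Prod>l\<in>K. pminor (M l) ({q\<in>insert p T. s q = l} \<union> U))"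
    by (rule sum_PiE_insert[OF insert.hyps(2), symmetric])
  finally show ?case using subleading_coeff_nonzero[OF deg roots] by simp
qed

section \<open>The mixed determinantal polynomial as an average of characteristic polynomials\<close>

lemma bij_betw_pick:
  assumes "finite S"
  shows "bij_betw (pick S) {..<card S} S"
proof -
  have "inj_on (pick S) {..<card S}"
    by (intro linorder_inj_onI) (auto dest: pick_mono[OF disjI1])
  moreover have "pick S ` {..<card S} \<subseteq> S" using pick_in_set by auto
  ultimately show ?thesis
    using assms by (simp add: bij_betw_def card_image card_subset_eq)
qed

text \<open>Conjugation by the bijection matches the permutations of \<open>T\<close> with those of
  \<open>S\<close> and preserves signs.\<close>

lemma pminor_reindex:
  assumes f: "bij_betw f T S" and "finite T"
  shows "pminor (\<lambda>i j. M (f i) (f j)) T = pminor M S"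
proof -
  define g where "g = inv_into T f"
  have inj: "inj_on f T" and im: "f ` T = S" using f by (auto simp: bij_betw_def)
  have g: "bij_betw g S T" unfolding g_def by (rule bij_betw_inv_into[OF f])
  have "(\<Sum>\<pi> | \<pi> permutes S. of_int (sign \<pi>) * (\<Prod>i\<in>S. M i (\<pi> i)))
      = (\<Sum>\<pi> | \<pi> permutes T. of_int (sign \<pi>) * (\<Prod>i\<in>T. M (f i) (f (\<pi> i))))"
  proof (rule sum.reindex_bij_witness
      [where i = "map_permutation T f" and j = "map_permutation S g"])
    fix \<pi> assume "\<pi> \<in> {\<pi>. \<pi> permutes T}"
    then have \<pi>: "\<pi> permutes T" by simp
    show "map_permutation T f \<pi> \<in> {\<pi>. \<pi> permutes S}"
      using map_permutation_permutes[OF f \<pi>] by simp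
    show "map_permutation S g (map_permutation T f \<pi>) = \<pi>"
      using inj by (intro map_permutation_compose_inv[OF f \<pi>]) (simp add: g_def)
  next
    fix \<pi> assume "\<pi> \<in> {\<pi>. \<pi> permutes S}"
    then have \<pi>: "\<pi> permutes S" by simp
    show "map_permutation S g \<pi> \<in> {\<pi>. \<pi> permutes T}"
      using map_permutation_permutes[OF g \<pi>] by simp
    show "map_permutation T f (map_permutation S g \<pi>) = \<pi>"
      using f by (intro map_permutation_compose_inv[OF g \<pi>])
        (simp add: g_def bij_betw_inv_into_right)
    have "inj_on g S" using g by (auto simp: bij_betw_def)
    have "sign (map_permutation S g \<pi>) = sign \<pi>"
      using \<open>inj_on g S\<close> \<pi> assms by (intro sign_map_permutation) (auto simp: bij_betw_finite)
    moreover have "(\<Prod>i\<in>T. M (f i) (f (map_permutation S g \<pi> i))) = (\<Prod>i\<in>S. M i (\<pi> i))"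
    proof (rule prod.reindex_bij_betw[OF f, of "\<lambda>i. M i (\<pi> i)", symmetric, THEN trans, symmetric])
      show "(\<Prod>i\<in>T. M (f i) (\<pi> (f i))) = (\<Prod>i\<in>T. M (f i) (f (map_permutation S g \<pi> i)))"
      proof (rule prod.cong)
        fix i assume i: "i \<in> T"
        then have fi: "f i \<in> S" using im by auto
        then have \<pi>fi: "\<pi> (f i) \<in> S" using permutes_in_image[OF \<pi>] by simp
        have "map_permutation S g \<pi> i = map_permutation S g \<pi> (g (f i))"
          using i inj by (simp add: g_def)
        also have "\<dots> = g (\<pi> (f i))"
          using \<open>inj_on g S\<close> fi by (rule map_permutation_apply)
        finally have "f (map_permutation S g \<pi> i) = \<pi> (f i)"
          using \<pi>fi f by (simp add: g_def bij_betw_inv_into_right)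
        then show "M (f i) (\<pi> (f i)) = M (f i) (f (map_permutation S g \<pi> i))" by simp
      qed simp
    qed
    ultimately show "of_int (sign (map_permutation S g \<pi>)) * (\<Prod>i\<in>T. M (f i) (f (map_permutation S g \<pi> i)))
        = of_int (sign \<pi>) * (\<Prod>i\<in>S. M i (\<pi> i))" by simp
  qed
  then show ?thesis by (simp add: pminor_def)
qed

text \<open>\<open>submatrix\<close> renumbers \<open>S\<close> through \<open>pick\<close>;
  \<open>pminor_reindex\<close> undoes this, so that all parts of a partition live on the same index
  set again.\<close>

lemma poly_char_poly_submatrix:
  assumes A: "A \<in> carrier_mat n n" and S: "S \<subseteq> {..<n}"
  shows "poly (char_poly (submatrix A S S)) z
    = pminor (\<lambda>p q. (if p = q then z else 0) - A $$ (p, q)) S"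
proof -
  let ?m = "card S" and ?M = "\<lambda>p q. (if p = q then z else 0) - A $$ (p, q)"
  have fin: "finite S" using S finite_subset by blast
  have bij: "bij_betw (pick S) {..<?m} S" by (rule bij_betw_pick[OF fin])
  have "{i. i < n \<and> i \<in> S} = S" using S by auto
  then have sub: "submatrix A S S = mat ?m ?m (\<lambda>(i, j). A $$ (pick S i, pick S j))"
    using A by (simp add: submatrix_def)
  have "poly (char_poly (submatrix A S S)) z = det (mat ?m ?m (\<lambda>(i, j). ?M (pick S i) (pick S j)))"
    unfolding char_poly_def
  proof (rule poly_det_cong[of _ ?m])
    show "char_poly_matrix (submatrix A S S) \<in> carrier_mat ?m ?m"
      by (rule char_poly_matrix_closed) (simp add: sub)
    fix i j assume ij: "i < ?m" "j < ?m"
    then have "pick S i = pick S j \<longleftrightarrow> i = j"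
      using bij by (auto simp: bij_betw_def inj_on_def)
    then show "poly (char_poly_matrix (submatrix A S S) $$ (i, j)) z
        = mat ?m ?m (\<lambda>(i, j). ?M (pick S i) (pick S j)) $$ (i, j)"
      using ij by (simp add: char_poly_matrix_def sub)
  qed simp
  also have "\<dots> = pminor (\<lambda>i j. ?M (pick S i) (pick S j)) {..<?m}"
    by (rule det_mat_eq_pminor)
  also have "\<dots> = pminor ?M S"
    by (rule pminor_reindex[OF bij]) simp
  finally show ?thesis .
qed

text \<open>An ordered partition is the family of fibres of exactly one assignment of indices to
  parts. In this form its terms can be averaged over independent coordinates.\<close>

lemma sum_ordered_partitions:
  "(\<Sum>S\<in>ordered_partitions k n. F S)
    = (\<Sum>s\<in>{..<n} \<rightarrow>\<^sub>E {1..k}. F (\<lambda>j\<in>{1..k}. {p\<in>{..<n}. s p = j}))"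
proof -
  define fib :: "(nat \<Rightarrow> nat) \<Rightarrow> nat \<Rightarrow> nat set"
    where "fib s = (\<lambda>j\<in>{1..k}. {p\<in>{..<n}. s p = j})" for s
  have inj: "inj_on fib ({..<n} \<rightarrow>\<^sub>E {1..k})"
  proof (rule inj_onI)
    fix s t assume s: "s \<in> {..<n} \<rightarrow>\<^sub>E {1..k}" and t: "t \<in> {..<n} \<rightarrow>\<^sub>E {1..k}"
      and eq: "fib s = fib t"
    show "s = t"
    proof (rule PiE_ext[OF s t])
      fix p assume p: "p \<in> {..<n}"
      then have "s p \<in> {1..k}" by (rule PiE_mem[OF s])
      then have "fib s (s p) = {q\<in>{..<n}. s q = s p}"
        by (simp add: fib_def)
      then have "fib t (s p) = {q\<in>{..<n}. s q = s p}" by (simp only: eq)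
      then have "p \<in> fib t (s p)" using p by simp
      then show "s p = t p" using \<open>s p \<in> {1..k}\<close> by (simp add: fib_def)
    qed
  qed
  have "fib ` ({..<n} \<rightarrow>\<^sub>E {1..k}) = ordered_partitions k n"
  proof (intro equalityI subsetI)
    fix S assume "S \<in> fib ` ({..<n} \<rightarrow>\<^sub>E {1..k})"
    then obtain s where s: "s \<in> {..<n} \<rightarrow>\<^sub>E {1..k}" and S: "S = fib s" by auto
    have "p \<in> (\<Union>j\<in>{1..k}. S j)" if "p < n" for p
    proof (rule UN_I)
      show sp: "s p \<in> {1..k}" using that by (intro PiE_mem[OF s]) simp
      then show "p \<in> S (s p)" using that by (simp add: S fib_def)
    qed
    then show "S \<in> ordered_partitions k n"
      by (auto simp: S fib_def ordered_partitions_def disjoint_family_on_def)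
  next
    fix S assume "S \<in> ordered_partitions k n"
    then have S: "S \<in> {1..k} \<rightarrow>\<^sub>E Pow {..<n}" "disjoint_family_on S {1..k}"
        "(\<Union>j\<in>{1..k}. S j) = {..<n}"
      by (auto simp: ordered_partitions_def)
    have "\<forall>p\<in>{..<n}. \<exists>j\<in>{1..k}. p \<in> S j" using S(3) by blast
    then obtain s0 where s0: "\<And>p. p \<in> {..<n} \<Longrightarrow> s0 p \<in> {1..k} \<and> p \<in> S (s0 p)" by metis
    define s where "s = restrict s0 {..<n}"
    have s: "s \<in> {..<n} \<rightarrow>\<^sub>E {1..k}" using s0 by (auto simp: s_def)
    have "fib s = S"
    proof (rule PiE_ext)
      show "fib s \<in> {1..k} \<rightarrow>\<^sub>E Pow {..<n}" by (auto simp: fib_def)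
      fix j assume j: "j \<in> {1..k}"
      have "s p = j \<longleftrightarrow> p \<in> S j" if "p \<in> {..<n}" for p
      proof
        assume "p \<in> S j"
        moreover have "p \<in> S (s p)" "s p \<in> {1..k}" using s0[OF that] that by (auto simp: s_def)
        ultimately show "s p = j"
          using S(2) j unfolding disjoint_family_on_def by blast
      qed (use s0[OF that] that in \<open>auto simp: s_def\<close>)
      moreover have "S j \<subseteq> {..<n}" using S(1) j by auto
      ultimately show "fib s j = S j" using j by (auto simp: fib_def)
    qed (fact S(1))
    then show "S \<in> fib ` ({..<n} \<rightarrow>\<^sub>E {1..k})" using s by blast
  qed
  then have "(\<Sum>S\<in>ordered_partitions k n. F S) = (\<Sum>s\<in>{..<n} \<rightarrow>\<^sub>E {1..k}. F (fib s))"
    using sum.reindex[OF inj, of F] by simp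
  then show ?thesis by (simp add: fib_def)
qed

text \<open>The direct sum of the A_i[S_i] for the partition coded by \<open>s\<close>, left in its
  original coordinates.\<close>

definition block :: "(nat \<Rightarrow> complex mat) \<Rightarrow> (nat \<Rightarrow> nat) \<Rightarrow> nat \<Rightarrow> nat \<Rightarrow> complex" where
  "block A s p q = (if s p = s q then A (s p) $$ (p, q) else 0)"

lemma poly_mixed_det_poly:
  assumes A: "\<And>i. i \<in> {1..k} \<Longrightarrow> A i \<in> carrier_mat n n"
  shows "poly (mixed_det_poly k n A) z = 1 / of_nat k ^ n *
    (\<Sum>s\<in>{..<n} \<rightarrow>\<^sub>E {1..k}. pminor (\<lambda>p q. (if p = q then z else 0) - block A s p q) {..<n})"
proof -
  have "(\<Prod>j\<in>{1..k}. poly (char_poly (submatrix (A j) {p\<in>{..<n}. s p = j} {p\<in>{..<n}. s p = j})) z)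
      = pminor (\<lambda>p q. (if p = q then z else 0) - block A s p q) {..<n}"
    if s: "s \<in> {..<n} \<rightarrow>\<^sub>E {1..k}" for s
  proof -
    have "(\<Prod>j\<in>{1..k}. poly (char_poly (submatrix (A j) {p\<in>{..<n}. s p = j} {p\<in>{..<n}. s p = j})) z)
        = (\<Prod>j\<in>{1..k}. pminor (\<lambda>p q. (if p = q then z else 0) - A j $$ (p, q)) {p\<in>{..<n}. s p = j})"
      using A by (intro prod.cong poly_char_poly_submatrix) auto
    also have "\<dots> = pminor (\<lambda>p q. if s p = s q then (if p = q then z else 0) - A (s p) $$ (p, q) else 0) {..<n}"
      using s by (intro prod_pminor_fibers) auto
    also have "\<dots> = pminor (\<lambda>p q. (if p = q then z else 0) - block A s p q) {..<n}"
      by (rule pminor_cong) (auto simp: block_def)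
    finally show ?thesis .
  qed
  then show ?thesis
    by (simp add: mixed_det_poly_def poly_sum poly_prod sum_ordered_partitions)
qed

section \<open>Expansion of the resolvent at infinity\<close>

text \<open>Matrix determinant lemma, with \<open>V\<close> in the role of the inverse of
  \<open>M\<close> applied to \<open>U\<close>. The matrix bordered by \<open>U\<close>,
  \<open>W\<close> and the corner -1 is evaluated twice: column operations clear \<open>W\<close>
  and leave \<open>M + U * W\<close>, whereas a triangular factorization through \<open>V\<close>
  leaves \<open>M\<close> and the corner \<open>c\<close>.\<close>

lemma det_rank_one_update:
  fixes M :: "complex mat"
  assumes M: "M \<in> carrier_mat n n" and U: "U \<in> carrier_mat n 1" and W: "W \<in> carrier_mat 1 n"
    and V: "V \<in> carrier_mat n 1" and MV: "M * V = U"
  shows "det (M + U * W) = det M * (1 + (W * V) $$ (0, 0))"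
proof -
  define e :: "complex mat" where "e = mat 1 1 (\<lambda>_. -1)"
  define c where "c = mat 1 1 (\<lambda>_. - 1 - (W * V) $$ (0, 0))"
  have e: "e \<in> carrier_mat 1 1" and c: "c \<in> carrier_mat 1 1" by (simp_all add: e_def c_def)
  let ?N = "four_block_mat M U W e"
  have "det ?N = det (?N * four_block_mat (1\<^sub>m n) (0\<^sub>m n 1) W (1\<^sub>m 1))"
    using M U W e
    by (subst det_mult[of _ "n + 1"])
      (auto simp: det_four_block_mat_upper_right_zero[of _ n _ 1])
  also have "?N * four_block_mat (1\<^sub>m n) (0\<^sub>m n 1) W (1\<^sub>m 1)
      = four_block_mat (M + U * W) U (0\<^sub>m 1 n) e"
  proof -
    have "W * 1\<^sub>m n + e * W = 0\<^sub>m 1 n"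
      using W by (intro eq_matI) (auto simp: e_def scalar_prod_def)
    then show ?thesis
      using M U W e by (subst mult_four_block_mat[of _ n n _ 1 _ 1 _ _ n _ 1]) auto
  qed
  also have "det \<dots> = det (M + U * W) * det e"
    using M U W e by (intro det_four_block_mat_lower_left_zero[of _ n _ 1]) auto
  finally have 1: "det ?N = - det (M + U * W)" by (simp add: e_def det_single)
  have "?N = four_block_mat M (0\<^sub>m n 1) W (1\<^sub>m 1) * four_block_mat (1\<^sub>m n) V (0\<^sub>m 1 n) c"
  proof -
    have "W * V + c = e"
      using W V by (intro eq_matI) (auto simp: e_def c_def)
    then show ?thesis
      using M U W V c MV by (subst mult_four_block_mat[of _ n n _ 1 _ 1 _ _ n _ 1]) auto
  qed
  also have "det \<dots> = det M * det c"
    using M W V c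
    by (subst det_mult[of _ "n + 1"])
      (auto simp: det_four_block_mat_upper_right_zero[of _ n _ 1] det_four_block_mat_lower_left_zero[of _ n _ 1])
  finally show ?thesis using 1 by (simp add: c_def det_single algebra_simps)
qed

text \<open>The elementary symmetric functions of degree 1 and 2, up to sign, expressed by power
  sums (Newton), since power sums of eigenvalues are traces.\<close>

lemma coeff_prod_one_minus:
  fixes t :: "'i \<Rightarrow> complex"
  assumes "finite I"
  shows "coeff (\<Prod>i\<in>I. [:1, - t i:]) 0 = 1"
    and "coeff (\<Prod>i\<in>I. [:1, - t i:]) (Suc 0) = - (\<Sum>i\<in>I. t i)"
    and "2 * coeff (\<Prod>i\<in>I. [:1, - t i:]) (Suc (Suc 0)) = (\<Sum>i\<in>I. t i)\<^sup>2 - (\<Sum>i\<in>I. (t i)\<^sup>2)"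
  using assms
proof (induction I)
  case (insert i I)
  { case 1 then show ?case using insert by simp }
  { case 2 then show ?case using insert by simp }
  { case 3 show ?case using insert by (simp add: algebra_simps power2_eq_square) }
qed simp_all

text \<open>In the variable \<open>y = 1 / x\<close> the leading coefficients sit at the indices 0, 1, 2 for every dimension,
  and \<open>adj (I - y B) = det (I - y B) I + y adj (I - y B) B\<close> determines them.\<close>

definition rev_char_poly :: "nat \<Rightarrow> (nat \<Rightarrow> nat \<Rightarrow> complex) \<Rightarrow> complex poly" where
  "rev_char_poly n B = det (mat n n (\<lambda>(p, q). [:if p = q then 1 else 0, - B p q:]))"

definition rev_adj :: "nat \<Rightarrow> (nat \<Rightarrow> nat \<Rightarrow> complex) \<Rightarrow> nat \<Rightarrow> nat \<Rightarrow> complex poly" where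
  "rev_adj n B p q = adj_mat (mat n n (\<lambda>(p, q). [:if p = q then 1 else 0, - B p q:])) $$ (p, q)"

lemma poly_rev_char_poly:
  "poly (rev_char_poly n B) y = pminor (\<lambda>p q. (if p = q then 1 else 0) - y * B p q) {..<n}"
  unfolding rev_char_poly_def det_mat_eq_pminor[symmetric]
  by (rule poly_det_cong[of _ n]) auto

lemma sum_mult_delta_minus:
  fixes f g :: "nat \<Rightarrow> 'a::comm_ring_1"
  assumes "q < n"
  shows "(\<Sum>r<n. f r * ((if r = q then 1 else 0) - g r)) = f q - (\<Sum>r<n. f r * g r)"
    and "(\<Sum>r<n. ((if q = r then 1 else 0) - g r) * f r) = f q - (\<Sum>r<n. g r * f r)"
proof -
  have "(\<Sum>r<n. f r * (if r = q then 1 else 0)) = f q"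
    using assms by (simp add: if_distrib[of "\<lambda>x. _ * x"] cong: if_cong)
  then show "(\<Sum>r<n. f r * ((if r = q then 1 else 0) - g r)) = f q - (\<Sum>r<n. f r * g r)"
    by (simp add: right_diff_distrib sum_subtractf)
  have "(\<Sum>r<n. (if q = r then 1 else 0) * f r) = f q"
    using assms by (simp add: if_distrib[of "\<lambda>x. x * _"] cong: if_cong)
  then show "(\<Sum>r<n. ((if q = r then 1 else 0) - g r) * f r) = f q - (\<Sum>r<n. g r * f r)"
    by (simp add: left_diff_distrib sum_subtractf)
qed

text \<open>The adjugate times the matrix, in either order, is the determinant times the identity;
  \<open>pCons 0\<close> is multiplication by y. The first order yields the coefficients in
  \<open>rev_adj_coeffs\<close>, the second solves \<open>M * V = U\<close> in
  \<open>pminor_rank_one_update\<close>.\<close>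

lemma rev_adj_rec:
  assumes "p < n" "q < n"
  shows "rev_adj n B p q = (if p = q then rev_char_poly n B else 0)
      + pCons 0 (\<Sum>r<n. smult (B r q) (rev_adj n B p r))"
    and "rev_adj n B p q = (if p = q then rev_char_poly n B else 0)
      + pCons 0 (\<Sum>r<n. smult (B p r) (rev_adj n B r q))"
proof -
  let ?M = "mat n n (\<lambda>(p, q). [:if p = q then 1 else 0, - B p q:])"
  have M: "?M \<in> carrier_mat n n" by simp
  have pc: "(\<Sum>r<n. pCons 0 (h r)) = pCons 0 (\<Sum>r<n. h r)" for h :: "nat \<Rightarrow> complex poly"
    by (induction n) simp_all
  have entry: "[:if p = q then 1 else 0, - B p q:] = (if p = q then 1 else 0) - [:0, B p q:]" for p q
    by (simp add: one_pCons)
  have "rev_adj n B p q - (\<Sum>r<n. rev_adj n B p r * [:0, B r q:])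
      = (\<Sum>r<n. rev_adj n B p r * [:if r = q then 1 else 0, - B r q:])"
    unfolding entry by (rule sum_mult_delta_minus(1)[OF assms(2), symmetric])
  also have "\<dots> = (adj_mat ?M * ?M) $$ (p, q)"
    using assms adj_mat(1)[OF M] by (simp add: scalar_prod_def rev_adj_def atLeast0LessThan)
  also have "\<dots> = (if p = q then rev_char_poly n B else 0)"
    unfolding adj_mat(3)[OF M] using assms by (simp add: rev_char_poly_def)
  finally show "rev_adj n B p q = (if p = q then rev_char_poly n B else 0)
      + pCons 0 (\<Sum>r<n. smult (B r q) (rev_adj n B p r))"
    by (simp add: algebra_simps pc)
  have "rev_adj n B p q - (\<Sum>r<n. [:0, B p r:] * rev_adj n B r q)
      = (\<Sum>r<n. [:if p = r then 1 else 0, - B p r:] * rev_adj n B r q)"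
    unfolding entry by (rule sum_mult_delta_minus(2)[OF assms(1), symmetric])
  also have "\<dots> = (?M * adj_mat ?M) $$ (p, q)"
    using assms adj_mat(1)[OF M] by (simp add: scalar_prod_def rev_adj_def atLeast0LessThan)
  also have "\<dots> = (if p = q then rev_char_poly n B else 0)"
    unfolding adj_mat(2)[OF M] using assms by (simp add: rev_char_poly_def)
  finally show "rev_adj n B p q = (if p = q then rev_char_poly n B else 0)
      + pCons 0 (\<Sum>r<n. smult (B p r) (rev_adj n B r q))"
    by (simp add: algebra_simps pc)
qed

text \<open>In the matrix determinant lemma the inverse is written as adjugate over determinant; the
  determinant then cancels, and the result is polynomial in \<open>y\<close>.\<close>

lemma pminor_rank_one_update:
  assumes nz: "poly (rev_char_poly n B) y \<noteq> 0"
  shows "pminor (\<lambda>p q. (if p = q then 1 else 0) - y * B p q + u p * w q) {..<n}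
    = poly (rev_char_poly n B) y + (\<Sum>p<n. \<Sum>q<n. w p * poly (rev_adj n B p q) y * u q)"
proof -
  let ?d = "poly (rev_char_poly n B) y"
  define M where "M = mat n n (\<lambda>(p, q). (if p = q then 1 else 0) - y * B p q)"
  define U where "U = mat n 1 (\<lambda>(p, _). u p)"
  define W where "W = mat 1 n (\<lambda>(_, q). w q)"
  define V where "V = mat n 1 (\<lambda>(p, _). (\<Sum>q<n. poly (rev_adj n B p q) y * u q) / ?d)"
  have dims: "M \<in> carrier_mat n n" "U \<in> carrier_mat n 1" "W \<in> carrier_mat 1 n" "V \<in> carrier_mat n 1"
    by (simp_all add: M_def U_def W_def V_def)
  have detM: "det M = ?d" by (simp add: M_def det_mat_eq_pminor poly_rev_char_poly)
  have "M * V = U"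
  proof (rule eq_matI)
    fix p j assume "p < dim_row U" "j < dim_col U"
    then have p: "p < n" and j: "j = 0" by (auto simp: U_def)
    have row: "(\<Sum>r<n. ((if p = r then 1 else 0) - y * B p r) * poly (rev_adj n B r q) y)
        = (if p = q then ?d else 0)" if "q < n" for q
      unfolding sum_mult_delta_minus(2)[OF p]
      by (subst rev_adj_rec(2)[OF p that]) (simp add: poly_sum sum_distrib_left mult.assoc)
    have "(M * V) $$ (p, j)
        = (\<Sum>r<n. ((if p = r then 1 else 0) - y * B p r) * ((\<Sum>q<n. poly (rev_adj n B r q) y * u q) / ?d))"
      using p j by (simp add: M_def V_def scalar_prod_def atLeast0LessThan)
    also have "\<dots> = (\<Sum>r<n. \<Sum>q<n. ((if p = r then 1 else 0) - y * B p r) * poly (rev_adj n B r q) y * u q) / ?d"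
      by (simp add: sum_distrib_left sum_divide_distrib mult.assoc)
    also have "\<dots> = (\<Sum>q<n. (\<Sum>r<n. ((if p = r then 1 else 0) - y * B p r) * poly (rev_adj n B r q) y) * u q) / ?d"
      by (subst sum.swap) (simp add: sum_distrib_right)
    also have "\<dots> = (\<Sum>q<n. if q = p then ?d * u p else 0) / ?d"
      using row by (intro arg_cong2[of _ _ _ _ "(/)"] sum.cong refl) auto
    also have "\<dots> = u p" using p nz by simp
    finally show "(M * V) $$ (p, j) = U $$ (p, j)" using p j by (simp add: U_def)
  qed (simp_all add: M_def V_def U_def)
  from det_rank_one_update[OF dims this]
  have "det (M + U * W) = ?d * (1 + (W * V) $$ (0, 0))" by (simp add: detM)
  moreover have "M + U * W = mat n n (\<lambda>(p, q). (if p = q then 1 else 0) - y * B p q + u p * w q)"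
    by (rule eq_matI) (auto simp: M_def U_def W_def scalar_prod_def)
  moreover have "(W * V) $$ (0, 0) = (\<Sum>p<n. w p * ((\<Sum>q<n. poly (rev_adj n B p q) y * u q) / ?d))"
    by (simp add: W_def V_def scalar_prod_def atLeast0LessThan)
  moreover have "\<dots> = (\<Sum>p<n. \<Sum>q<n. w p * poly (rev_adj n B p q) y * u q) / ?d"
    by (simp add: sum_distrib_left sum_divide_distrib mult.assoc)
  ultimately show ?thesis
    using nz by (simp add: det_mat_eq_pminor distrib_left)
qed

text \<open>Schur decomposition makes \<open>B\<close> similar to a triangular \<open>T\<close>.
  Similarity keeps det (I - y B) and the traces of B and of its square, which for \<open>T\<close>
  are a product of linear factors and power sums of the diagonal.\<close>

lemma rev_char_poly_coeffs:
  "coeff (rev_char_poly n B) 0 = 1"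
  "coeff (rev_char_poly n B) (Suc 0) = - (\<Sum>p<n. B p p)"
  "2 * coeff (rev_char_poly n B) (Suc (Suc 0)) = (\<Sum>p<n. B p p)\<^sup>2 - (\<Sum>p<n. \<Sum>q<n. B p q * B q p)"
proof -
  define A where "A = mat n n (\<lambda>(p, q). B p q)"
  have A: "A \<in> carrier_mat n n" by (simp add: A_def)
  obtain es where "char_poly A = (\<Prod>e\<leftarrow>es. [:- e, 1:])" using char_poly_factorized[OF A] by blast
  then obtain T where T: "T \<in> carrier_mat n n" and ut: "upper_triangular T" and "similar_mat A T"
    using schur_decomposition_exists[OF A] by blast
  then obtain P Q where wit: "similar_mat_wit A T P Q" unfolding similar_mat_def by blast
  have PQ: "P \<in> carrier_mat n n" "Q \<in> carrier_mat n n" "P * Q = 1\<^sub>m n" "Q * P = 1\<^sub>m n"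
      "A = P * T * Q"
    using similar_mat_witD2[OF A wit] by simp_all
  have trace: "(\<Sum>p<n. (P * X * Q) $$ (p, p)) = (\<Sum>p<n. X $$ (p, p))" if X: "X \<in> carrier_mat n n" for X
  proof -
    have tr: "(\<Sum>p<n. (Y * Z) $$ (p, p)) = (\<Sum>p<n. (Z * Y) $$ (p, p))"
      if "Y \<in> carrier_mat n n" "Z \<in> carrier_mat n n" for Y Z :: "complex mat"
    proof -
      have "(\<Sum>p<n. (Y * Z) $$ (p, p)) = (\<Sum>p<n. \<Sum>q<n. Y $$ (p, q) * Z $$ (q, p))"
        using that by (intro sum.cong) (auto simp: scalar_prod_def atLeast0LessThan)
      also have "\<dots> = (\<Sum>p<n. \<Sum>q<n. Z $$ (p, q) * Y $$ (q, p))"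
        by (subst sum.swap) (simp add: mult.commute)
      also have "\<dots> = (\<Sum>p<n. (Z * Y) $$ (p, p))"
        using that by (intro sum.cong) (auto simp: scalar_prod_def atLeast0LessThan)
      finally show ?thesis .
    qed
    have "(\<Sum>p<n. (P * X * Q) $$ (p, p)) = (\<Sum>p<n. (Q * (P * X)) $$ (p, p))"
      using PQ X by (intro tr) auto
    also have "Q * (P * X) = X"
      using assoc_mult_mat[OF PQ(2,1) X] PQ(4) X by simp
    finally show ?thesis .
  qed
  have tr1: "(\<Sum>p<n. B p p) = (\<Sum>p<n. T $$ (p, p))"
    using trace[OF T] by (simp add: PQ(5)[symmetric] A_def)
  have "A * A = P * (T * T) * Q"
  proof -
    have "A * A = P * T * (Q * P) * T * Q"
      unfolding PQ(5) using PQ(1,2) T by (simp add: assoc_mult_mat[of _ n n _ n _ n])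
    also have "\<dots> = P * (T * T) * Q"
      unfolding PQ(4) using PQ(1,2) T by (simp add: assoc_mult_mat[of _ n n _ n _ n])
    finally show ?thesis .
  qed
  then have "(\<Sum>p<n. (A * A) $$ (p, p)) = (\<Sum>p<n. (T * T) $$ (p, p))"
    using trace[of "T * T"] T by simp
  moreover have "(\<Sum>p<n. (A * A) $$ (p, p)) = (\<Sum>p<n. \<Sum>q<n. B p q * B q p)"
    by (intro sum.cong) (auto simp: A_def scalar_prod_def atLeast0LessThan)
  moreover have "(T * T) $$ (p, p) = (T $$ (p, p))\<^sup>2" if p: "p < n" for p
  proof -
    have "(T * T) $$ (p, p) = (\<Sum>q<n. T $$ (p, q) * T $$ (q, p))"
      using p T by (auto simp: scalar_prod_def atLeast0LessThan)
    also have "\<dots> = (\<Sum>q<n. if q = p then (T $$ (p, p))\<^sup>2 else 0)"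
    proof (intro sum.cong refl)
      fix q assume q: "q \<in> {..<n}"
      consider "q < p" | "q = p" | "p < q" by linarith
      then show "T $$ (p, q) * T $$ (q, p) = (if q = p then (T $$ (p, p))\<^sup>2 else 0)"
        using upper_triangularD[OF ut] p q T by cases (auto simp: power2_eq_square)
    qed
    also have "\<dots> = (T $$ (p, p))\<^sup>2" using p by simp
    finally show ?thesis .
  qed
  ultimately have tr2: "(\<Sum>p<n. \<Sum>q<n. B p q * B q p) = (\<Sum>p<n. (T $$ (p, p))\<^sup>2)" by simp
  have "poly (rev_char_poly n B) y = poly (\<Prod>p<n. [:1, - T $$ (p, p):]) y" for y
  proof -
    let ?D = "\<lambda>X. 1\<^sub>m n + (- y) \<cdot>\<^sub>m X"
    have "poly (rev_char_poly n B) y = det (?D A)"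
      unfolding poly_rev_char_poly det_mat_eq_pminor[symmetric]
      by (intro arg_cong[of _ _ det] eq_matI) (auto simp: A_def)
    also have "?D A = P * ?D T * Q"
    proof -
      have "P * ?D T = P * 1\<^sub>m n + P * ((- y) \<cdot>\<^sub>m T)"
        using PQ(1) T by (intro mult_add_distrib_mat[of _ n n _ n]) auto
      also have "\<dots> * Q = P * 1\<^sub>m n * Q + P * ((- y) \<cdot>\<^sub>m T) * Q"
        using PQ(1,2) T by (intro add_mult_distrib_mat[of _ n n _ _ n]) auto
      also have "P * 1\<^sub>m n * Q = 1\<^sub>m n" using PQ(1,3) by simp
      also have "P * ((- y) \<cdot>\<^sub>m T) = (- y) \<cdot>\<^sub>m (P * T)"
        using PQ(1) T by (rule mult_smult_distrib)
      also have "\<dots> * Q = (- y) \<cdot>\<^sub>m A"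
        unfolding PQ(5) using PQ(1,2) T by (intro mult_smult_assoc_mat[of _ n n _ n]) auto
      finally show ?thesis ..
    qed
    also have "det \<dots> = det (P * Q) * det (?D T)"
      using PQ(1,2) T by (simp add: det_mult[of _ n])
    also have "\<dots> = det (?D T)" by (simp add: PQ(3))
    also have "\<dots> = prod_list (diag_mat (?D T))"
      using T ut by (intro det_upper_triangular[of _ n]) (auto simp: upper_triangular_def)
    also have "\<dots> = (\<Prod>p<n. 1 - y * T $$ (p, p))"
      using T by (simp add: diag_mat_def prod.list_conv_set_nth atLeast0LessThan)
    finally show ?thesis by (simp add: poly_prod)
  qed
  then have eq: "rev_char_poly n B = (\<Prod>p<n. [:1, - T $$ (p, p):])"
    by (intro poly_eq_poly_eq_iff[THEN iffD1] ext)
  show "coeff (rev_char_poly n B) 0 = 1"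
    "coeff (rev_char_poly n B) (Suc 0) = - (\<Sum>p<n. B p p)"
    "2 * coeff (rev_char_poly n B) (Suc (Suc 0)) = (\<Sum>p<n. B p p)\<^sup>2 - (\<Sum>p<n. \<Sum>q<n. B p q * B q p)"
    unfolding eq tr1 tr2 by (simp_all only: coeff_prod_one_minus finite_lessThan)
qed

text \<open>Each use of the recursion gains one order in y. Trace zero removes the linear
  coefficient of the determinant, so with its quadratic coefficient d the adjugate begins with I + y
  B + y^2 (B^2 + d I).\<close>

lemma rev_adj_coeffs:
  assumes pq: "p < n" "q < n" and tr: "(\<Sum>p<n. B p p) = 0"
  shows "coeff (rev_adj n B p q) 0 = (if p = q then 1 else 0)"
    and "coeff (rev_adj n B p q) (Suc 0) = B p q"
    and "coeff (rev_adj n B p q) (Suc (Suc 0))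
      = (if p = q then coeff (rev_char_poly n B) (Suc (Suc 0)) else 0) + (\<Sum>r<n. B p r * B r q)"
proof -
  have 0: "coeff (rev_adj n B p q) 0 = (if p = q then 1 else 0)" if "q < n" for q
    by (subst rev_adj_rec(1)[OF pq(1) that]) (simp add: rev_char_poly_coeffs)
  show "coeff (rev_adj n B p q) 0 = (if p = q then 1 else 0)" by (rule 0[OF pq(2)])
  have 1: "coeff (rev_adj n B p q) (Suc 0) = B p q" if q: "q < n" for q
  proof -
    have "coeff (rev_adj n B p q) (Suc 0) = (\<Sum>r<n. B r q * coeff (rev_adj n B p r) 0)"
      by (subst rev_adj_rec(1)[OF pq(1) q]) (simp add: rev_char_poly_coeffs tr coeff_sum)
    also have "\<dots> = (\<Sum>r<n. if r = p then B p q else 0)"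
      by (intro sum.cong refl) (simp add: 0)
    finally show ?thesis using pq(1) by simp
  qed
  show "coeff (rev_adj n B p q) (Suc 0) = B p q" by (rule 1[OF pq(2)])
  show "coeff (rev_adj n B p q) (Suc (Suc 0))
      = (if p = q then coeff (rev_char_poly n B) (Suc (Suc 0)) else 0) + (\<Sum>r<n. B p r * B r q)"
    by (subst rev_adj_rec(1)[OF pq]) (simp add: coeff_sum 1 mult.commute)
qed

section \<open>Partial fractions of functions mapping the upper half plane to the lower one\<close>

text \<open>Along the direction \<open>\<zeta>\<close> the function behaves near \<open>x\<close>
  like a constant divided by (e \<open>\<zeta>\<close>)^m. The sign condition survives
  multiplication by the positive number e^m and the limit e to 0.\<close>

lemma herglotz_boundary:
  fixes Q H :: "complex poly" and x :: real
  assumes H: "poly H (of_real x) \<noteq> 0" and \<zeta>: "\<zeta> \<noteq> 0" "Im \<zeta> \<ge> 0"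
    and le: "\<And>z. Im z > 0 \<Longrightarrow> Im (poly Q z / ((z - of_real x) ^ m * poly H z)) \<le> 0"
  shows "Im (poly Q (of_real x) / poly H (of_real x) / \<zeta> ^ m) \<le> 0"
proof -
  \<comment> \<open>The correction \<open>\<i> * of_real e\<close> keeps the approaching point in
    the open half plane even when \<open>\<zeta>\<close> is real.\<close>
  define g where "g e = poly Q (of_real x + of_real e * (\<zeta> + \<i> * of_real e))
    / ((\<zeta> + \<i> * of_real e) ^ m * poly H (of_real x + of_real e * (\<zeta> + \<i> * of_real e)))" for e :: real
  have "Im (g e) \<le> 0" if e: "e > 0" for e
  proof -
    let ?\<zeta> = "\<zeta> + \<i> * of_real e"
    let ?z = "of_real x + of_real e * ?\<zeta>"
    have "Im ?z = e * (Im \<zeta> + e)" by (simp add: algebra_simps)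
    then have "Im ?z > 0" using e \<zeta>(2) by simp
    from le[OF this] have "Im (poly Q ?z / ((of_real e * ?\<zeta>) ^ m * poly H ?z)) \<le> 0" by simp
    also have "poly Q ?z / ((of_real e * ?\<zeta>) ^ m * poly H ?z) = g e / of_real (e ^ m)"
      by (simp add: g_def power_mult_distrib)
    finally show ?thesis using zero_less_power[OF e, of m]
      by (auto simp: Im_divide_of_real divide_le_0_iff)
  qed
  then have "\<forall>\<^sub>F e in at_right 0. Im (g e) \<le> 0"
    by (auto simp: eventually_at_right_less intro: eventually_mono[OF eventually_at_right_less])
  moreover have "((\<lambda>e. Im (g e)) \<longlongrightarrow>
      Im (poly Q (of_real x + of_real 0 * (\<zeta> + \<i> * of_real 0))
        / ((\<zeta> + \<i> * of_real 0) ^ m * poly H (of_real x + of_real 0 * (\<zeta> + \<i> * of_real 0))))) (at_right 0)"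
    unfolding g_def using H \<zeta> by (intro tendsto_intros) auto
  ultimately show ?thesis
    by (auto dest!: tendsto_upperbound simp: divide_divide_eq_left mult.commute)
qed

text \<open>For m at least 2 the powers \<open>\<zeta> ^ m\<close> of the closed upper half plane
  reach every direction, so some quotient points upwards. For m = 1 the directions 1 and -1 force a
  real \<open>c\<close>, and the direction \<open>\<i>\<close> fixes its sign.\<close>

lemma herglotz_residue:
  fixes c :: complex
  assumes c: "c \<noteq> 0" and m: "m > 0"
    and le: "\<And>\<zeta>. \<zeta> \<noteq> 0 \<Longrightarrow> Im \<zeta> \<ge> 0 \<Longrightarrow> Im (c / \<zeta> ^ m) \<le> 0"
  shows "m = 1" "Im c = 0" "Re c \<ge> 0"
proof -
  show m1: "m = 1"
  proof (rule ccontr)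
    assume "m \<noteq> 1"
    with m have m2: "m \<ge> 2" by simp
    \<comment> \<open>The angle from \<open>pi / 2\<close> to \<open>Arg c\<close>, taken in
      [0, 2 pi]: dividing \<open>c\<close> by \<open>cis \<alpha>\<close> turns it onto the positive
      imaginary axis, and \<open>\<alpha> / m\<close> is at most \<open>pi\<close> as m is at least
      2.\<close>
    define \<alpha> where "\<alpha> = (if Arg c \<ge> pi / 2 then Arg c - pi / 2 else Arg c - pi / 2 + 2 * pi)"
    have \<alpha>: "0 \<le> \<alpha>" "\<alpha> \<le> 2 * pi"
      using Arg_bounded[of c] by (auto simp: \<alpha>_def)
    have "\<alpha> / m \<le> \<alpha> / 2"
      using m2 \<alpha> by (intro divide_left_mono) auto
    also have "\<alpha> / 2 \<le> pi" using \<alpha> by simp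
    finally have "\<alpha> / m \<le> pi" .
    moreover have "0 \<le> \<alpha> / m" using \<alpha> by simp
    ultimately have "Im (cis (\<alpha> / m)) \<ge> 0" by (simp add: sin_ge_zero)
    from le[OF cis_neq_zero this] have "Im (c / cis (\<alpha> / m) ^ m) \<le> 0" .
    also have "cis (\<alpha> / m) ^ m = cis \<alpha>" using m by (simp add: DeMoivre)
    also have "c / cis \<alpha> = of_real (cmod c) * cis (Arg c - \<alpha>)"
      by (subst rcis_cmod_Arg[of c, symmetric]) (simp add: rcis_def cis_divide[symmetric])
    also have "cis (Arg c - \<alpha>) = \<i>"
    proof -
      have "Arg c - \<alpha> = pi / 2 \<or> Arg c - \<alpha> = pi / 2 - 2 * pi" by (auto simp: \<alpha>_def)
      then show ?thesis
        by (elim disjE) (simp_all only: cis_divide[symmetric] cis_2pi div_by_1 cis_pi_half)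
    qed
    finally show False using c by simp
  qed
  show "Im c = 0" using le[of 1] le[of "-1"] m1 by simp
  show "Re c \<ge> 0" using le[of \<i>] m1 by simp
qed

text \<open>Nodes may coincide, as chi may have multiple roots; hence a polynomial identity rather
  than one of fractions. If \<open>Q\<close> vanishes at a node, one factor cancels and induction
  applies. Otherwise the order of each pole is the multiplicity of its node, so
  \<open>herglotz_residue\<close> makes all nodes simple with non-negative residues, and Lagrange
  interpolation recovers \<open>Q\<close>.\<close>

lemma partial_fractions_nonneg:
  fixes \<mu> :: "'i \<Rightarrow> real" and Q :: "complex poly"
  assumes "finite I" and "Q = 0 \<or> degree Q < card I"
    and "\<And>z. Im z > 0 \<Longrightarrow> Im (poly Q z / (\<Prod>i\<in>I. z - of_real (\<mu> i))) \<le> 0"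
  shows "\<exists>w :: 'i \<Rightarrow> real. (\<forall>i\<in>I. 0 \<le> w i) \<and>
    Q = (\<Sum>i\<in>I. smult (of_real (w i)) (\<Prod>j\<in>I - {i}. [:- of_real (\<mu> j), 1:]))"
  using assms
proof (induction "card I" arbitrary: I Q)
  case 0
  then show ?case by simp
next
  case (Suc m)
  have fin: "finite I" by fact
  show ?case
  proof (cases "\<exists>i\<in>I. poly Q (of_real (\<mu> i)) = 0")
    case True
    then obtain i Q' where i: "i \<in> I" and Q: "Q = [:- of_real (\<mu> i), 1:] * Q'"
      by (auto simp: poly_eq_0_iff_dvd elim!: dvdE)
    have card: "card (I - {i}) = m" using Suc.hyps(2) i fin by simp
    have "Q' = 0 \<or> degree Q' < card (I - {i})"
    proof (cases "Q' = 0")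
      case False
      then have "degree Q = Suc (degree Q')" unfolding Q by (subst degree_mult_eq) auto
      then show ?thesis using Suc.prems(2) Suc.hyps(2) card False Q by auto
    qed simp
    moreover have "Im (poly Q' z / (\<Prod>j\<in>I - {i}. z - of_real (\<mu> j))) \<le> 0" if z: "Im z > 0" for z
    proof -
      have "z - of_real (\<mu> i) \<noteq> 0" using z by auto
      moreover have "poly Q z = (z - of_real (\<mu> i)) * poly Q' z"
        by (simp add: Q algebra_simps)
      ultimately have "poly Q z / (\<Prod>j\<in>I. z - of_real (\<mu> j)) = poly Q' z / (\<Prod>j\<in>I - {i}. z - of_real (\<mu> j))"
        unfolding prod.remove[OF fin i] by simp
      then show ?thesis using Suc.prems(3)[OF z] by simp
    qed
    ultimately obtain w where w: "\<forall>j\<in>I - {i}. 0 \<le> w j"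
      "Q' = (\<Sum>j\<in>I - {i}. smult (of_real (w j)) (\<Prod>l\<in>I - {i} - {j}. [:- of_real (\<mu> l), 1:]))"
      using Suc.hyps(1)[of "I - {i}" Q'] card fin by auto
    have "Q = (\<Sum>j\<in>I - {i}. smult (of_real (w j)) (\<Prod>l\<in>I - {j}. [:- of_real (\<mu> l), 1:]))"
      unfolding Q w(2) sum_distrib_left
    proof (intro sum.cong refl)
      fix j assume j: "j \<in> I - {i}"
      have "I - {i} - {j} = I - {j} - {i}" by auto
      moreover have "(\<Prod>l\<in>I - {j}. [:- of_real (\<mu> l), 1:] :: complex poly)
          = [:- of_real (\<mu> i), 1:] * (\<Prod>l\<in>I - {j} - {i}. [:- of_real (\<mu> l), 1:])"
        using fin i j by (intro prod.remove) auto
      ultimately show "[:- of_real (\<mu> i), 1:] * smult (of_real (w j)) (\<Prod>l\<in>I - {i} - {j}. [:- of_real (\<mu> l), 1:])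
          = (smult (of_real (w j)) (\<Prod>l\<in>I - {j}. [:- of_real (\<mu> l), 1:]) :: complex poly)"
        by (simp only: mult_smult_right)
    qed
    \<comment> \<open>The cancelled node \<open>i\<close> receives weight 0.\<close>
    also have "\<dots> = (\<Sum>j\<in>I. smult (of_real ((w(i := 0)) j)) (\<Prod>l\<in>I - {j}. [:- of_real (\<mu> l), 1:]))"
      using fin by (intro sum.mono_neutral_cong_left) auto
    finally show ?thesis using w(1) by (intro exI[of _ "w(i := 0)"]) auto
  next
    case False
    define c where "c i = poly Q (of_real (\<mu> i)) / (\<Prod>j\<in>I - {i}. of_real (\<mu> i) - of_real (\<mu> j))" for i
    have *: "{j\<in>I. \<mu> j = \<mu> i} = {i} \<and> Im (c i) = 0 \<and> Re (c i) \<ge> 0" if i: "i \<in> I" for i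
    proof -
      \<comment> \<open>All nodes coinciding with \<open>\<mu> i\<close>. Since \<open>Q\<close>
        does not vanish there, the order of the pole is exactly \<open>card S\<close>.\<close>
      define S where "S = {j\<in>I. \<mu> j = \<mu> i}"
      define H where "H = (\<Prod>j\<in>I - S. [:- of_real (\<mu> j), 1:] :: complex poly)"
      define a where "a = poly Q (of_real (\<mu> i)) / poly H (of_real (\<mu> i))"
      have S: "S \<subseteq> I" "finite S" "i \<in> S" using fin i by (auto simp: S_def)
      have H: "poly H (of_real (\<mu> i)) \<noteq> 0"
        using fin by (auto simp: H_def S_def poly_prod)
      have split: "(\<Prod>j\<in>I. z - of_real (\<mu> j)) = (z - of_real (\<mu> i)) ^ card S * poly H z" for z :: complex
      proof -
        have "(\<Prod>j\<in>S. z - of_real (\<mu> j)) = (\<Prod>j\<in>S. z - of_real (\<mu> i))"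
          by (rule prod.cong) (auto simp: S_def)
        then show ?thesis
          using prod.subset_diff[OF S(1) fin, of "\<lambda>j. z - of_real (\<mu> j)"]
          by (simp add: H_def poly_prod mult.commute)
      qed
      have le: "Im (a / \<zeta> ^ card S) \<le> 0" if "\<zeta> \<noteq> 0" "Im \<zeta> \<ge> 0" for \<zeta>
        unfolding a_def using Suc.prems(3) by (intro herglotz_boundary H that) (simp add: split)
      have "a \<noteq> 0" using False i H by (simp add: a_def)
      moreover have "card S > 0" using S by (auto simp: card_gt_0_iff)
      ultimately have res: "card S = 1" "Im a = 0" "Re a \<ge> 0"
        using herglotz_residue[of a "card S"] le by blast+
      then have "S = {i}" using S by (auto simp: card_1_singleton_iff)
      moreover have "a = c i" by (simp add: a_def c_def H_def \<open>S = {i}\<close> poly_prod)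
      ultimately show ?thesis using res by (simp add: S_def)
    qed
    have inj: "inj_on (\<lambda>i. complex_of_real (\<mu> i)) I"
    proof (rule inj_onI)
      fix i j assume "i \<in> I" "j \<in> I" "complex_of_real (\<mu> i) = complex_of_real (\<mu> j)"
      then have "j \<in> {j\<in>I. \<mu> j = \<mu> i}" by simp
      also have "\<dots> = {i}" using *[OF \<open>i \<in> I\<close>] by (rule conjunct1)
      finally show "i = j" by simp
    qed
    let ?R = "\<Sum>i\<in>I. smult (of_real (Re (c i))) (\<Prod>j\<in>I - {i}. [:- of_real (\<mu> j), 1:]) :: complex poly"
    have "Q = ?R"
    \<comment> \<open>Both sides have degree below the number of nodes, now known to be distinct,
      and agree at each of them.\<close>
    proof (rule poly_eqI_degree[of "(\<lambda>i. complex_of_real (\<mu> i)) ` I"])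
      have cardI: "card ((\<lambda>i. complex_of_real (\<mu> i)) ` I) = card I"
        by (rule card_image[OF inj])
      show "degree Q < card ((\<lambda>i. complex_of_real (\<mu> i)) ` I)"
        using Suc.prems(2) Suc.hyps(2) cardI by auto
      have "degree ?R \<le> m"
      proof (intro degree_sum_le fin order.trans[OF degree_smult_le])
        fix i assume "i \<in> I"
        then have "card (I - {i}) = m" using Suc.hyps(2) fin by simp
        then show "degree (\<Prod>j\<in>I - {i}. [:- of_real (\<mu> j), 1:] :: complex poly) \<le> m"
          using coeff_prod_linear(1)[of "I - {i}" "\<lambda>j. - of_real (\<mu> j)" "\<lambda>_. 1"] fin by simp
      qed
      then show "degree ?R < card ((\<lambda>i. complex_of_real (\<mu> i)) ` I)"
        using Suc.hyps(2) cardI by simp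
      fix z assume "z \<in> (\<lambda>i. complex_of_real (\<mu> i)) ` I"
      then obtain i where i: "i \<in> I" and z: "z = of_real (\<mu> i)" by auto
      have zero: "(\<Prod>j\<in>I - {l}. z - of_real (\<mu> j)) = 0" if "l \<in> I - {i}" for l
        using that i z fin by (intro prod_zero) auto
      have "poly ?R z = (\<Sum>l\<in>I. of_real (Re (c l)) * (\<Prod>j\<in>I - {l}. z - of_real (\<mu> j)))"
        by (simp add: poly_sum poly_prod)
      also have "\<dots> = (\<Sum>l\<in>{i}. of_real (Re (c l)) * (\<Prod>j\<in>I - {l}. z - of_real (\<mu> j)))"
        by (rule sum.mono_neutral_right[OF fin]) (use i zero in simp_all)
      also have "\<dots> = of_real (Re (c i)) * (\<Prod>j\<in>I - {i}. z - of_real (\<mu> j))" by simp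
      also have "of_real (Re (c i)) = c i" using *[OF i] by (simp add: complex_eq_iff)
      also have "c i * (\<Prod>j\<in>I - {i}. z - of_real (\<mu> j)) = poly Q z"
      proof -
        have "(\<Prod>j\<in>I - {i}. z - of_real (\<mu> j)) \<noteq> 0"
          using inj i fin by (auto simp: z inj_on_def)
        then show ?thesis by (simp add: c_def z)
      qed
      finally show "poly Q z = poly ?R z" by simp
    qed
    then show ?thesis using * by (intro exI[of _ "\<lambda>i. Re (c i)"]) auto
  qed
qed

section \<open>Averages over assignments\<close>

text \<open>Independence of the coordinates: the indicator factors over them, and each prescribed
  coordinate contributes 1 where a free one contributes \<open>k\<close>.\<close>

lemma count_assignments:
  assumes X: "X \<subseteq> {..<n}" and c: "\<And>p. p \<in> X \<Longrightarrow> c p \<in> {1..k}" and k: "k \<ge> 1"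
  shows "(\<Sum>s\<in>{..<n} \<rightarrow>\<^sub>E {1..k}. if \<forall>p\<in>X. s p = c p then 1 else 0) = (of_nat k ^ n / of_nat k ^ card X :: complex)"
proof -
  let ?f = "\<lambda>p i. if p \<in> X \<longrightarrow> i = c p then 1 else 0 :: complex"
  have finX: "finite X" using X finite_subset by blast
  have "(\<Prod>p<n. ?f p (s p)) = (if \<forall>p\<in>X. s p = c p then 1 else 0)" for s
  proof (cases "\<forall>p\<in>X. s p = c p")
    case False
    then obtain p where "p \<in> X" "s p \<noteq> c p" by auto
    then have "(\<Prod>p<n. ?f p (s p)) = 0" using X by (intro prod_zero bexI[of _ p]) auto
    then show ?thesis using False by simp
  qed simp
  then have "(\<Sum>s\<in>{..<n} \<rightarrow>\<^sub>E {1..k}. if \<forall>p\<in>X. s p = c p then 1 else 0)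
      = (\<Sum>s\<in>{..<n} \<rightarrow>\<^sub>E {1..k}. \<Prod>p<n. ?f p (s p))" by simp
  also have "\<dots> = (\<Prod>p<n. \<Sum>i\<in>{1..k}. ?f p i)"
    by (rule prod_sum_PiE[symmetric]) auto
  also have "\<dots> = (\<Prod>p<n. if p \<in> X then 1 else of_nat k)"
    using c by (intro prod.cong refl) auto
  also have "\<dots> = of_nat k ^ card ({..<n} - X)"
    by (simp add: prod.If_cases Diff_eq[symmetric] Compl_eq[symmetric])
  also have "card ({..<n} - X) = n - card X" using X finX by (simp add: card_Diff_subset)
  also have "of_nat k ^ (n - card X) = (of_nat k ^ n / of_nat k ^ card X :: complex)"
    using card_mono[OF _ X] k by (simp add: power_diff)
  finally show ?thesis .
qed

lemma count_assignments1:
  assumes "p < n" "i \<in> {1..k}"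
  shows "(\<Sum>s\<in>{..<n} \<rightarrow>\<^sub>E {1..k}. if s p = i then 1 else 0) = (of_nat k ^ n / of_nat k :: complex)"
  using count_assignments[of "{p}" n "\<lambda>_. i" k] assms by simp

lemma count_assignments2:
  assumes "p < n" "q < n" "p \<noteq> q" "i \<in> {1..k}" "j \<in> {1..k}"
  shows "(\<Sum>s\<in>{..<n} \<rightarrow>\<^sub>E {1..k}. if s p = i \<and> s q = j then 1 else 0) = (of_nat k ^ n / of_nat k ^ 2 :: complex)"
  using count_assignments[of "{p, q}" n "\<lambda>r. if r = p then i else j" k] assms by (simp add: power2_eq_square)

lemma count_assignments3:
  assumes "p < n" "q < n" "r < n" "p \<noteq> q" "p \<noteq> r" "q \<noteq> r" "i \<in> {1..k}" "j \<in> {1..k}" "l \<in> {1..k}"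
  shows "(\<Sum>s\<in>{..<n} \<rightarrow>\<^sub>E {1..k}. if s p = i \<and> s q = j \<and> s r = l then 1 else 0)
    = (of_nat k ^ n / of_nat k ^ 3 :: complex)"
  using count_assignments[of "{p, q, r}" n "\<lambda>t. if t = p then i else if t = q then j else l" k] assms
  by (simp add: power3_eq_cube mult.assoc)

lemma sum_sum_if_swap:
  "(\<Sum>s\<in>F. \<Sum>p\<in>X. if P s p then (c p :: complex) else 0) = (\<Sum>p\<in>X. c p * (\<Sum>s\<in>F. if P s p then 1 else 0))"
  by (subst sum.swap) (simp add: sum_distrib_left if_distrib[of "\<lambda>x. _ * x"] cong: if_cong)

text \<open>The component of a vector in part \<open>j\<close>. The rank-one term is attached to A_j
  alone, so only this component of v enters the direct sum of \<open>s\<close>.\<close>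

definition restr :: "nat \<Rightarrow> (nat \<Rightarrow> nat) \<Rightarrow> (nat \<Rightarrow> complex) \<Rightarrow> nat \<Rightarrow> complex" where
  "restr j s f p = (if s p = j then f p else 0)"

context
  fixes k n j :: nat and A :: "nat \<Rightarrow> complex mat" and x y :: "nat \<Rightarrow> complex"
  assumes j: "j \<in> {1..k}"
    and zd: "\<And>i p. i \<in> {1..k} \<Longrightarrow> p < n \<Longrightarrow> A i $$ (p, p) = 0"
begin

lemma sum_moment0:
  "(\<Sum>s\<in>{..<n} \<rightarrow>\<^sub>E {1..k}. \<Sum>p<n. restr j s x p * restr j s y p) = of_nat k ^ n / of_nat k * (\<Sum>p<n. x p * y p)"
proof -
  have "(\<Sum>s\<in>{..<n} \<rightarrow>\<^sub>E {1..k}. \<Sum>p<n. restr j s x p * restr j s y p)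
      = (\<Sum>s\<in>{..<n} \<rightarrow>\<^sub>E {1..k}. \<Sum>p<n. if s p = j then x p * y p else 0)"
    by (intro sum.cong refl) (simp add: restr_def)
  also have "\<dots> = (\<Sum>p<n. x p * y p * (of_nat k ^ n / of_nat k))"
    unfolding sum_sum_if_swap using j by (intro sum.cong refl arg_cong2[of _ _ _ _ "(*)"] count_assignments1) auto
  finally show ?thesis by (simp add: sum_distrib_left mult_ac)
qed

text \<open>Two distinct indices both fall into part \<open>j\<close> with probability 1 / k^2.
  Pairs with \<open>p = q\<close> would have probability 1 / k, but their entries are zero.\<close>

lemma sum_moment1:
  "(\<Sum>s\<in>{..<n} \<rightarrow>\<^sub>E {1..k}. \<Sum>p<n. \<Sum>q<n. restr j s x p * block A s p q * restr j s y q)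
    = of_nat k ^ n / of_nat k ^ 2 * (\<Sum>p<n. \<Sum>q<n. x p * A j $$ (p, q) * y q)"
proof -
  have "(\<Sum>s\<in>{..<n} \<rightarrow>\<^sub>E {1..k}. \<Sum>p<n. \<Sum>q<n. restr j s x p * block A s p q * restr j s y q)
      = (\<Sum>s\<in>{..<n} \<rightarrow>\<^sub>E {1..k}. \<Sum>(p, q)\<in>{..<n} \<times> {..<n}.
          if s p = j \<and> s q = j then x p * A j $$ (p, q) * y q else 0)"
    by (simp add: restr_def block_def sum.cartesian_product[symmetric]) (intro sum.cong refl, auto)
  also have "\<dots> = (\<Sum>(p, q)\<in>{..<n} \<times> {..<n}. x p * A j $$ (p, q) * y q
      * (\<Sum>s\<in>{..<n} \<rightarrow>\<^sub>E {1..k}. if s p = j \<and> s q = j then 1 else 0))"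
    by (simp only: case_prod_unfold sum_sum_if_swap)
  also have "\<dots> = (\<Sum>(p, q)\<in>{..<n} \<times> {..<n}. x p * A j $$ (p, q) * y q * (of_nat k ^ n / of_nat k ^ 2))"
  proof (intro sum.cong refl, clarify)
    fix p q assume "p < n" "q < n"
    then show "x p * A j $$ (p, q) * y q * (\<Sum>s\<in>{..<n} \<rightarrow>\<^sub>E {1..k}. if s p = j \<and> s q = j then 1 else 0)
        = x p * A j $$ (p, q) * y q * (of_nat k ^ n / of_nat k ^ 2)"
      using zd[OF j, of p] count_assignments2[of p n q j k j] j by (cases "p = q") auto
  qed
  finally show ?thesis by (simp add: sum.cartesian_product sum_distrib_left mult_ac case_prod_unfold)
qed

text \<open>The zero diagonal makes \<open>r\<close> differ from \<open>p\<close> and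
  \<open>q\<close>. A path with three distinct indices has probability 1 / k^3, a closed one with
  \<open>p = q\<close> has 1 / k^2, that is \<open>k\<close> times as much; the surplus is the
  diagonal term with factor \<open>k - 1\<close>.\<close>

lemma sum_moment2_path:
  "(\<Sum>s\<in>{..<n} \<rightarrow>\<^sub>E {1..k}. \<Sum>p<n. \<Sum>q<n. restr j s x p * (\<Sum>r<n. block A s p r * block A s r q) * restr j s y q)
    = of_nat k ^ n / of_nat k ^ 3 * ((\<Sum>p<n. \<Sum>q<n. x p * (\<Sum>r<n. A j $$ (p, r) * A j $$ (r, q)) * y q)
        + (of_nat k - 1) * (\<Sum>p<n. x p * y p * (\<Sum>r<n. A j $$ (p, r) * A j $$ (r, p))))"
proof -
  let ?N = "of_nat k ^ n / of_nat k ^ 3 :: complex"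
  let ?T = "{..<n} \<times> {..<n} \<times> {..<n}"
  let ?a = "\<lambda>p q r. x p * (A j $$ (p, r) * A j $$ (r, q)) * y q"
  have k: "of_nat k \<noteq> (0 :: complex)" using j by auto
  have "(\<Sum>s\<in>{..<n} \<rightarrow>\<^sub>E {1..k}. \<Sum>p<n. \<Sum>q<n. restr j s x p * (\<Sum>r<n. block A s p r * block A s r q) * restr j s y q)
      = (\<Sum>s\<in>{..<n} \<rightarrow>\<^sub>E {1..k}. \<Sum>p<n. \<Sum>q<n. \<Sum>r<n. if s p = j \<and> s q = j \<and> s r = j then ?a p q r else 0)"
    unfolding sum_distrib_left sum_distrib_right
    by (intro sum.cong refl) (auto simp: restr_def block_def)
  also have "\<dots> = (\<Sum>s\<in>{..<n} \<rightarrow>\<^sub>E {1..k}. \<Sum>(p, q, r)\<in>?T. if s p = j \<and> s q = j \<and> s r = j then ?a p q r else 0)"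
    by (simp add: sum.cartesian_product)
  also have "\<dots> = (\<Sum>(p, q, r)\<in>?T. ?a p q r
      * (\<Sum>s\<in>{..<n} \<rightarrow>\<^sub>E {1..k}. if s p = j \<and> s q = j \<and> s r = j then 1 else 0))"
    by (simp only: case_prod_unfold sum_sum_if_swap)
  also have "\<dots> = (\<Sum>(p, q, r)\<in>?T. ?N * (?a p q r + (if p = q then (of_nat k - 1) * ?a p q r else 0)))"
  proof (intro sum.cong refl, clarify)
    fix p q r assume pqr: "p < n" "q < n" "r < n"
    show "?a p q r * (\<Sum>s\<in>{..<n} \<rightarrow>\<^sub>E {1..k}. if s p = j \<and> s q = j \<and> s r = j then 1 else 0)
        = ?N * (?a p q r + (if p = q then (of_nat k - 1) * ?a p q r else 0))"
    proof (cases "p = r \<or> r = q")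
      case True
      then show ?thesis using zd[OF j] pqr by auto
    next
      case False
      show ?thesis
      proof (cases "p = q")
        case True
        then have "(\<Sum>s\<in>{..<n} \<rightarrow>\<^sub>E {1..k}. if s p = j \<and> s q = j \<and> s r = j then 1 else 0) = (of_nat k ^ n / of_nat k ^ 2 :: complex)"
          using count_assignments2[of p n r j k j] j False pqr by simp
        also have "\<dots> = of_nat k * ?N" using k by (simp add: power3_eq_cube power2_eq_square)
        finally show ?thesis using True by (simp add: algebra_simps)
      next
        case ne: False
        have "(\<Sum>s\<in>{..<n} \<rightarrow>\<^sub>E {1..k}. if s p = j \<and> s q = j \<and> s r = j then 1 else 0) = ?N"
          using count_assignments3[of p n q r j k j j] j False pqr ne by simp
        then show ?thesis using ne by simp
      qed
    qed
  qed
  also have "\<dots> = (\<Sum>p<n. \<Sum>q<n. \<Sum>r<n. ?N * (?a p q r + (if p = q then (of_nat k - 1) * ?a p q r else 0)))"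
    by (simp add: sum.cartesian_product)
  also have "\<dots> = ?N * ((\<Sum>p<n. \<Sum>q<n. \<Sum>r<n. ?a p q r)
      + (\<Sum>p<n. \<Sum>q<n. \<Sum>r<n. if p = q then (of_nat k - 1) * ?a p q r else 0))"
    by (simp only: sum_distrib_left[symmetric] sum.distrib)
  also have "(\<Sum>p<n. \<Sum>q<n. \<Sum>r<n. if p = q then (of_nat k - 1) * ?a p q r else 0)
      = (\<Sum>p<n. \<Sum>q<n. if p = q then \<Sum>r<n. (of_nat k - 1) * ?a p q r else 0)"
    by (rule sum.cong[OF refl], rule sum.cong[OF refl]) simp
  also have "\<dots> = (\<Sum>p<n. \<Sum>r<n. (of_nat k - 1) * ?a p p r)"
    by (rule sum.cong[OF refl]) simp
  finally show ?thesis
    by (simp add: sum_distrib_left sum_distrib_right mult_ac)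
qed

text \<open>Here \<open>s r = j\<close> is uncorrelated with \<open>s p = i \<and> s q = i\<close> unless \<open>r \<in> {p, q}\<close>.\<close>

lemma sum_moment2_cov:
  "(\<Sum>s\<in>{..<n} \<rightarrow>\<^sub>E {1..k}. (\<Sum>p<n. \<Sum>q<n. block A s p q * block A s q p)
      * ((\<Sum>r<n. restr j s x r * restr j s y r) - (\<Sum>r<n. x r * y r) / of_nat k))
    = 2 * (of_nat k ^ n / of_nat k ^ 3) * (\<Sum>r<n. x r * y r *
        (of_nat k * (\<Sum>q<n. A j $$ (r, q) * A j $$ (q, r)) - (\<Sum>i\<in>{1..k}. \<Sum>q<n. A i $$ (r, q) * A i $$ (q, r))))"
proof -
  let ?F = "{..<n} \<rightarrow>\<^sub>E {1..k}"
  let ?N = "of_nat k ^ n / of_nat k ^ 3 :: complex"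
  let ?b = "\<lambda>i p q. A i $$ (p, q) * A i $$ (q, p)"
  let ?I = "\<lambda>P. if P then 1 else 0 :: complex"
  have k: "of_nat k \<noteq> (0 :: complex)" using j by auto
  \<comment> \<open>Summing over the common part \<open>i\<close> of \<open>p\<close> and
    \<open>q\<close> leaves events that prescribe values of \<open>s\<close>, which the counting
    lemmas handle.\<close>
  have blk: "block A s p q * block A s q p = (\<Sum>i\<in>{1..k}. ?I (s p = i \<and> s q = i) * ?b i p q)"
    if "s \<in> ?F" "p < n" for s p q
  proof -
    have "s p \<in> {1..k}" using that by (intro PiE_mem[OF that(1)]) simp
    then have "(\<Sum>i\<in>{1..k}. ?I (s p = i \<and> s q = i) * ?b i p q) = (\<Sum>i\<in>{s p}. ?I (s p = i \<and> s q = i) * ?b i p q)"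
      by (intro sum.mono_neutral_right) auto
    then show ?thesis by (simp add: block_def)
  qed
  have "(\<Sum>s\<in>?F. (\<Sum>p<n. \<Sum>q<n. block A s p q * block A s q p)
      * ((\<Sum>r<n. restr j s x r * restr j s y r) - (\<Sum>r<n. x r * y r) / of_nat k))
    = (\<Sum>s\<in>?F. (\<Sum>p<n. \<Sum>q<n. \<Sum>i\<in>{1..k}. ?I (s p = i \<and> s q = i) * ?b i p q)
      * (\<Sum>r<n. x r * y r * (?I (s r = j) - 1 / of_nat k)))"
  proof (intro sum.cong refl arg_cong2[of _ _ _ _ "(*)"])
    fix s assume "s \<in> ?F"
    have "restr j s x r * restr j s y r - x r * y r / of_nat k = x r * y r * (?I (s r = j) - 1 / of_nat k)" for r
      by (simp add: restr_def right_diff_distrib)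
    then show "(\<Sum>r<n. restr j s x r * restr j s y r) - (\<Sum>r<n. x r * y r) / of_nat k
        = (\<Sum>r<n. x r * y r * (?I (s r = j) - 1 / of_nat k))"
      by (simp add: sum_divide_distrib sum_subtractf[symmetric])
  qed (simp add: blk)
  also have "\<dots> = (\<Sum>s\<in>?F. \<Sum>r<n. \<Sum>p<n. \<Sum>q<n. \<Sum>i\<in>{1..k}. x r * y r * (?b i p q *
      (?I (s p = i \<and> s q = i) * (?I (s r = j) - 1 / of_nat k))))"
  proof (rule sum.cong[OF refl])
    fix s
    have prod: "X * (\<Sum>r<n. g r) = (\<Sum>r<n. g r * X)" for X :: complex and g
      by (simp add: sum_distrib_left mult.commute)
    show "(\<Sum>p<n. \<Sum>q<n. \<Sum>i\<in>{1..k}. ?I (s p = i \<and> s q = i) * ?b i p q)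
        * (\<Sum>r<n. x r * y r * (?I (s r = j) - 1 / of_nat k))
      = (\<Sum>r<n. \<Sum>p<n. \<Sum>q<n. \<Sum>i\<in>{1..k}. x r * y r * (?b i p q *
        (?I (s p = i \<and> s q = i) * (?I (s r = j) - 1 / of_nat k))))"
      by (subst prod) (simp only: sum_distrib_left, simp only: mult_ac)
  qed
  also have "\<dots> = (\<Sum>r<n. \<Sum>p<n. \<Sum>q<n. \<Sum>i\<in>{1..k}. \<Sum>s\<in>?F. x r * y r * (?b i p q *
      (?I (s p = i \<and> s q = i) * (?I (s r = j) - 1 / of_nat k))))"
    by (simp only: sum.swap[of _ _ ?F])
  also have "\<dots> = (\<Sum>r<n. \<Sum>p<n. \<Sum>q<n. \<Sum>i\<in>{1..k}. x r * y r * (?b i p q *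
      (\<Sum>s\<in>?F. ?I (s p = i \<and> s q = i) * (?I (s r = j) - 1 / of_nat k))))"
    by (simp only: sum_distrib_left)
  \<comment> \<open>For \<open>p \<noteq> q\<close>: if \<open>r\<close> is one of them, the triple
    event is the pair event together with \<open>i = j\<close>, so the covariance is (k [i = j] - 1)
    / k^3; otherwise the events are independent and it is 0. For \<open>p = q\<close> the product of
    entries vanishes.\<close>
  also have "\<dots> = (\<Sum>r<n. \<Sum>p<n. \<Sum>q<n. \<Sum>i\<in>{1..k}. x r * y r * (?b i p q *
      (?N * (of_nat k * ?I (i = j) - 1) * (?I (p = r) + ?I (q = r)))))"
  proof (intro sum.cong refl)
    fix r p q i assume "r \<in> {..<n}" "p \<in> {..<n}" "q \<in> {..<n}" and i: "i \<in> {1..k}"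
    then have rpq: "r < n" "p < n" "q < n" by auto
    show "x r * y r * (?b i p q * (\<Sum>s\<in>?F. ?I (s p = i \<and> s q = i) * (?I (s r = j) - 1 / of_nat k)))
      = x r * y r * (?b i p q * (?N * (of_nat k * ?I (i = j) - 1) * (?I (p = r) + ?I (q = r))))"
    proof (cases "p = q")
      case True
      then show ?thesis using zd[OF i] rpq by simp
    next
      case False
      have "?I (s p = i \<and> s q = i) * (?I (s r = j) - 1 / of_nat k)
          = ?I (s p = i \<and> s q = i \<and> s r = j) - ?I (s p = i \<and> s q = i) / of_nat k" for s by simp
      then have "(\<Sum>s\<in>?F. ?I (s p = i \<and> s q = i) * (?I (s r = j) - 1 / of_nat k))
          = (\<Sum>s\<in>?F. ?I (s p = i \<and> s q = i \<and> s r = j)) - (\<Sum>s\<in>?F. ?I (s p = i \<and> s q = i)) / of_nat k"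
        by (simp only: sum_subtractf sum_divide_distrib)
      also have "(\<Sum>s\<in>?F. ?I (s p = i \<and> s q = i)) / of_nat k = ?N"
        using count_assignments2[OF rpq(2,3) False i i] by (simp add: power3_eq_cube power2_eq_square)
      also have "(\<Sum>s\<in>?F. ?I (s p = i \<and> s q = i \<and> s r = j))
          = ?N * (1 + (of_nat k * ?I (i = j) - 1) * (?I (p = r) + ?I (q = r)))"
      proof (cases "r = p \<or> r = q")
        case True
        then have "?I (s p = i \<and> s q = i \<and> s r = j) = ?I (i = j) * ?I (s p = i \<and> s q = i)" for s by auto
        then have "(\<Sum>s\<in>?F. ?I (s p = i \<and> s q = i \<and> s r = j)) = ?I (i = j) * (of_nat k ^ n / of_nat k ^ 2)"
          using count_assignments2[OF rpq(2,3) False i i] by (simp only: sum_distrib_left[symmetric])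
        moreover have "?I (p = r) + ?I (q = r) = 1" using True False by auto
        moreover have "of_nat k ^ n / of_nat k ^ 2 = of_nat k * ?N"
          using k by (simp add: power3_eq_cube power2_eq_square)
        ultimately show ?thesis by simp
      next
        case ne: False
        then show ?thesis
          using count_assignments3[of p n q r i k i j] rpq i j False by auto
      qed
      also have "?N * (1 + X) - ?N = ?N * X" for X by (simp add: distrib_left)
      finally show ?thesis by (simp only: mult.assoc)
    qed
  qed
  also have "\<dots> = (\<Sum>r<n. x r * y r * (?N * (\<Sum>i\<in>{1..k}. (of_nat k * ?I (i = j) - 1) * (2 * (\<Sum>q<n. ?b i r q)))))"
  proof (intro sum.cong refl)
    fix r assume r: "r \<in> {..<n}"
    \<comment> \<open>\<open>?b\<close> is symmetric in \<open>p\<close> and \<open>q\<close>, so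
      the coincidences \<open>p = r\<close> and \<open>q = r\<close> contribute equally. The
      resulting 2 later cancels the 1 / 2 in the second coefficient of the characteristic
      polynomial.\<close>
    have pq: "(\<Sum>p<n. \<Sum>q<n. ?b i p q * (?I (p = r) + ?I (q = r))) = 2 * (\<Sum>q<n. ?b i r q)" for i
    proof -
      have "(\<Sum>p<n. \<Sum>q<n. ?b i p q * ?I (p = r)) = (\<Sum>p<n. if p = r then \<Sum>q<n. ?b i p q else 0)"
        by (intro sum.cong refl) simp
      also have "\<dots> = (\<Sum>q<n. ?b i r q)" using r by simp
      finally have 1: "(\<Sum>p<n. \<Sum>q<n. ?b i p q * ?I (p = r)) = (\<Sum>q<n. ?b i r q)" .
      have "(\<Sum>p<n. \<Sum>q<n. ?b i p q * ?I (q = r)) = (\<Sum>p<n. \<Sum>q<n. ?b i p q * ?I (p = r))"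
        by (subst sum.swap) (simp add: mult.commute)
      then show ?thesis using 1 by (simp only: distrib_left sum.distrib mult_2)
    qed
    have "(\<Sum>p<n. \<Sum>q<n. \<Sum>i\<in>{1..k}. x r * y r * (?b i p q *
        (?N * (of_nat k * ?I (i = j) - 1) * (?I (p = r) + ?I (q = r)))))
      = (\<Sum>p<n. \<Sum>q<n. \<Sum>i\<in>{1..k}. x r * y r * (?N * ((of_nat k * ?I (i = j) - 1) *
        (?b i p q * (?I (p = r) + ?I (q = r))))))"
      by (simp only: mult_ac)
    also have "\<dots> = (\<Sum>i\<in>{1..k}. \<Sum>p<n. \<Sum>q<n. x r * y r * (?N * ((of_nat k * ?I (i = j) - 1) *
        (?b i p q * (?I (p = r) + ?I (q = r))))))"
      by (simp only: sum.swap[of _ "{..<n}" "{1..k}"])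
    also have "\<dots> = x r * y r * (?N * (\<Sum>i\<in>{1..k}. (of_nat k * ?I (i = j) - 1) * (2 * (\<Sum>q<n. ?b i r q))))"
      by (simp only: sum_distrib_left[symmetric] pq)
    finally show "(\<Sum>p<n. \<Sum>q<n. \<Sum>i\<in>{1..k}. x r * y r * (?b i p q *
        (?N * (of_nat k * ?I (i = j) - 1) * (?I (p = r) + ?I (q = r)))))
      = x r * y r * (?N * (\<Sum>i\<in>{1..k}. (of_nat k * ?I (i = j) - 1) * (2 * (\<Sum>q<n. ?b i r q))))" .
  qed
  also have "\<dots> = (\<Sum>r<n. 2 * ?N * (x r * y r * (of_nat k * (\<Sum>q<n. ?b j r q) - (\<Sum>i\<in>{1..k}. \<Sum>q<n. ?b i r q))))"
  proof (intro sum.cong refl)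
    fix r
    have "(\<Sum>i\<in>{1..k}. (of_nat k * ?I (i = j) - 1) * (2 * (\<Sum>q<n. ?b i r q)))
        = (\<Sum>i\<in>{1..k}. (if i = j then of_nat k * (2 * (\<Sum>q<n. ?b i r q)) else 0) - 2 * (\<Sum>q<n. ?b i r q))"
      by (intro sum.cong refl) (simp add: left_diff_distrib)
    also have "\<dots> = of_nat k * (2 * (\<Sum>q<n. ?b j r q)) - 2 * (\<Sum>i\<in>{1..k}. \<Sum>q<n. ?b i r q)"
      using j by (simp add: sum_subtractf sum_distrib_left)
    finally have eq: "(\<Sum>i\<in>{1..k}. (of_nat k * ?I (i = j) - 1) * (2 * (\<Sum>q<n. ?b i r q)))
        = of_nat k * (2 * (\<Sum>q<n. ?b j r q)) - 2 * (\<Sum>i\<in>{1..k}. \<Sum>q<n. ?b i r q)" .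
    show "x r * y r * (?N * (\<Sum>i\<in>{1..k}. (of_nat k * ?I (i = j) - 1) * (2 * (\<Sum>q<n. ?b i r q))))
        = 2 * ?N * (x r * y r * (of_nat k * (\<Sum>q<n. ?b j r q) - (\<Sum>i\<in>{1..k}. \<Sum>q<n. ?b i r q)))"
      unfolding eq by (simp add: algebra_simps)
  qed
  finally show ?thesis by (simp only: sum_distrib_left)
qed

end

section \<open>Rank-one perturbations\<close>

text \<open>The Hermitian \<open>a\<close> contributes a real number to the quadratic form at x, so
  its imaginary part is Im z |x|^2 + Im t |x^* v|^2.\<close>

lemma pos_im_shift:
  assumes herm: "\<And>p q. p < n \<Longrightarrow> q < n \<Longrightarrow> cnj (a p q) = a q p"
    and z: "Im z > 0" and t: "Im t \<ge> 0"
  shows "pos_im n (\<lambda>p q. (if p = q then z else 0) - a p q + t * (v p * cnj (v q)))"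
  unfolding pos_im_def
proof (intro allI impI)
  fix x :: "nat \<Rightarrow> complex" assume "\<exists>p<n. x p \<noteq> 0"
  then obtain p0 where p0: "p0 < n" "x p0 \<noteq> 0" by auto
  let ?S = "\<Sum>p<n. \<Sum>q<n. cnj (x p) * a p q * x q"
  have "cnj ?S = (\<Sum>p<n. \<Sum>q<n. x p * a q p * cnj (x q))"
    unfolding cnj_sum by (intro sum.cong refl) (simp add: herm)
  also have "\<dots> = ?S" by (subst sum.swap) (simp add: mult_ac)
  finally have "Im (cnj ?S) = Im ?S" by (rule arg_cong)
  then have S: "Im ?S = 0" unfolding cnj.sel by linarith
  have "(\<Sum>p<n. \<Sum>q<n. cnj (x p) * ((if p = q then z else 0) - a p q + t * (v p * cnj (v q))) * x q)
      = (\<Sum>p<n. \<Sum>q<n. if p = q then z * (x p * cnj (x p)) else 0) - ?S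
        + t * ((\<Sum>p<n. cnj (x p) * v p) * (\<Sum>q<n. cnj (v q) * x q))"
    unfolding sum_product
    unfolding sum_distrib_left sum_subtractf[symmetric] sum.distrib[symmetric]
    by (intro sum.cong refl) (simp add: algebra_simps)
  also have "(\<Sum>p<n. \<Sum>q<n. if p = q then z * (x p * cnj (x p)) else 0)
      = z * of_real (\<Sum>p<n. (cmod (x p))\<^sup>2)"
    by (simp add: sum_distrib_left complex_norm_square flip: of_real_power)
  also have "(\<Sum>q<n. cnj (v q) * x q) = cnj (\<Sum>p<n. cnj (x p) * v p)"
    by (simp add: mult.commute)
  also have "(\<Sum>p<n. cnj (x p) * v p) * cnj (\<Sum>p<n. cnj (x p) * v p)
      = of_real ((cmod (\<Sum>p<n. cnj (x p) * v p))\<^sup>2)"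
    by (rule complex_norm_square[symmetric])
  finally have "Im (\<Sum>p<n. \<Sum>q<n. cnj (x p) * ((if p = q then z else 0) - a p q + t * (v p * cnj (v q))) * x q)
      = Im z * (\<Sum>p<n. (cmod (x p))\<^sup>2) + Im t * (cmod (\<Sum>p<n. cnj (x p) * v p))\<^sup>2"
    using S by simp
  moreover have "(\<Sum>p<n. (cmod (x p))\<^sup>2) > 0"
    using p0 by (intro sum_pos2[of _ p0]) auto
  ultimately show "0 < Im (\<Sum>p<n. \<Sum>q<n. cnj (x p) * ((if p = q then z else 0) - a p q + t * (v p * cnj (v q))) * x q)"
    using z t by (simp add: add_pos_nonneg)
qed

lemma pminor_scale:
  assumes "finite S"
  shows "pminor (\<lambda>p q. c * M p q) S = c ^ card S * pminor M S"
  unfolding pminor_def by (simp add: prod.distrib sum_distrib_left mult_ac)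

text \<open>The passage to y = 1 / z: one factor \<open>z\<close> is taken out of each of the
  \<open>n\<close> rows.\<close>

lemma pminor_shift_scale:
  fixes z :: complex
  assumes "z \<noteq> 0"
  shows "pminor (\<lambda>p q. (if p = q then z else 0) - B p q + t * (u p * w q)) {..<n}
    = z ^ n * pminor (\<lambda>p q. (if p = q then 1 else 0) - 1 / z * B p q + (t / z * u p) * w q) {..<n}"
proof -
  have "pminor (\<lambda>p q. (if p = q then z else 0) - B p q + t * (u p * w q)) {..<n}
      = pminor (\<lambda>p q. z * ((if p = q then 1 else 0) - 1 / z * B p q + (t / z * u p) * w q)) {..<n}"
    using assms by (intro pminor_cong) (auto simp: field_simps)
  then show ?thesis by (simp add: pminor_scale)
qed

lemma poly_char_poly_mat:
  "poly (char_poly (mat n n (\<lambda>(p, q). B p q))) z = pminor (\<lambda>p q. (if p = q then z else 0) - B p q) {..<n}"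
  unfolding char_poly_def det_mat_eq_pminor[symmetric]
  by (rule poly_det_cong[of _ n]) (auto simp: char_poly_matrix_def)

lemma char_poly_mat_monic:
  fixes B :: "nat \<Rightarrow> nat \<Rightarrow> complex"
  shows "degree (char_poly (mat n n (\<lambda>(p, q). B p q))) = n"
    and "coeff (char_poly (mat n n (\<lambda>(p, q). B p q))) n = 1"
  using degree_monic_char_poly[of "mat n n (\<lambda>(p, q). B p q)" n] by auto

text \<open>Identities obtained for Im z > 0 hold in y = 1 / z for Im y < 0; this half plane
  contains infinitely many points, for instance on the imaginary axis.\<close>

lemma poly_eqI_lower_half_plane:
  fixes p q :: "complex poly"
  assumes "\<And>y. Im y < 0 \<Longrightarrow> poly p y = poly q y"
  shows "p = q"
proof (rule ccontr)
  assume "p \<noteq> q"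
  then have "finite {y. poly (p - q) y = 0}" by (intro poly_roots_finite) simp
  moreover have "range (\<lambda>m. - \<i> * of_nat (Suc m)) \<subseteq> {y. poly (p - q) y = 0}"
    using assms by auto
  ultimately have "finite (range (\<lambda>m. - \<i> * complex_of_nat (Suc m)))" by (rule rev_finite_subset)
  moreover have "inj (\<lambda>m. - \<i> * complex_of_nat (Suc m))" by (auto intro!: injI)
  ultimately show False using finite_imageD infinite_UNIV_nat by blast
qed

text \<open>Removing a factor multiplies P by the geometric series 1 + t_i y + t_i^2 y^2 + ...; its
  powers of t_i are what become moments of the weights.\<close>

lemma coeff_prod_one_minus_remove:
  fixes t :: "'i \<Rightarrow> complex"
  assumes "finite I" "i \<in> I"
  defines "P \<equiv> \<Prod>j\<in>I. [:1, - t j:]"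
  shows "coeff (\<Prod>j\<in>I - {i}. [:1, - t j:]) (Suc 0) = coeff P (Suc 0) + t i"
    and "coeff (\<Prod>j\<in>I - {i}. [:1, - t j:]) (Suc (Suc 0))
      = coeff P (Suc (Suc 0)) + t i * coeff P (Suc 0) + (t i)\<^sup>2"
proof -
  have P: "P = [:1, - t i:] * (\<Prod>j\<in>I - {i}. [:1, - t j:])"
    unfolding P_def using assms(1,2) by (rule prod.remove)
  have 0: "coeff (\<Prod>j\<in>I - {i}. [:1, - t j:]) 0 = 1"
    using assms(1) by (intro coeff_prod_one_minus) simp
  then show 1: "coeff (\<Prod>j\<in>I - {i}. [:1, - t j:]) (Suc 0) = coeff P (Suc 0) + t i"
    by (simp add: P)
  show "coeff (\<Prod>j\<in>I - {i}. [:1, - t j:]) (Suc (Suc 0))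
      = coeff P (Suc (Suc 0)) + t i * coeff P (Suc 0) + (t i)\<^sup>2"
    using 0 by (simp add: P algebra_simps power2_eq_square)
qed

lemma mixed_det_poly_eq_average:
  assumes A: "\<And>i. i \<in> {1..k} \<Longrightarrow> A i \<in> carrier_mat n n"
  shows "mixed_det_poly k n A = smult (1 / of_nat k ^ n)
    (\<Sum>s\<in>{..<n} \<rightarrow>\<^sub>E {1..k}. char_poly (mat n n (\<lambda>(p, q). block A s p q)))"
  by (rule poly_eqI_lower_half_plane)
    (simp only: poly_mixed_det_poly[of k A n, OF A] poly_smult poly_sum poly_char_poly_mat)

lemma card_assignments: "card ({..<n} \<rightarrow>\<^sub>E {1..k}) = k ^ n"
  by (simp add: card_PiE)

lemma mixed_det_poly_monic:
  assumes A: "\<And>i. i \<in> {1..k} \<Longrightarrow> A i \<in> carrier_mat n n" and k: "k \<ge> 1"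
  shows "degree (mixed_det_poly k n A) = n" and "coeff (mixed_det_poly k n A) n = 1"
proof -
  have eq: "mixed_det_poly k n A = smult (1 / of_nat k ^ n)
      (\<Sum>s\<in>{..<n} \<rightarrow>\<^sub>E {1..k}. char_poly (mat n n (\<lambda>(p, q). block A s p q)))"
    using A by (rule mixed_det_poly_eq_average)
  show 1: "coeff (mixed_det_poly k n A) n = 1"
    using k by (simp add: eq coeff_sum char_poly_mat_monic card_assignments del: One_nat_def)
  have "degree (mixed_det_poly k n A) \<le> n"
    unfolding eq
    by (intro order.trans[OF degree_smult_le] degree_sum_le finite_PiE) (auto simp: char_poly_mat_monic)
  then show "degree (mixed_det_poly k n A) = n"
    using 1 by (simp add: le_antisym le_degree)
qed

lemma mixed_det_poly_roots:
  assumes A: "\<And>i. i \<in> {1..k} \<Longrightarrow> A i \<in> carrier_mat n n" and k: "k \<ge> 1"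
    and roots: "all_roots_in (mixed_det_poly k n A) l r"
  obtains \<mu> :: "nat \<Rightarrow> real" where "\<And>i. i < n \<Longrightarrow> l \<le> \<mu> i \<and> \<mu> i \<le> r"
    and "mixed_det_poly k n A = (\<Prod>i<n. [:- of_real (\<mu> i), 1:])"
proof -
  let ?\<chi> = "mixed_det_poly k n A"
  have "degree ?\<chi> = n" "coeff ?\<chi> n = 1" 
    by (rule mixed_det_poly_monic, erule A, rule k)+
  then obtain as where as: "?\<chi> = (\<Prod>a\<leftarrow>as. [:- a, 1:])" "length as = n"
    using fundamental_theorem_algebra_factorized[of ?\<chi>] by (metis smult_1_left)
  have prod: "?\<chi> = (\<Prod>i<n. [:- (as ! i), 1:])"
    by (simp add: as prod.list_conv_set_nth atLeast0LessThan)
  have *: "as ! i \<in> complex_of_real ` {l..r}" if "i < n" for i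
  proof -
    have "poly ?\<chi> (as ! i) = 0"
      unfolding prod poly_prod using that by (intro prod_zero) auto
    then show ?thesis using roots by (simp add: all_roots_in_def)
  qed
  have re: "of_real (Re (as ! i)) = as ! i" if "i < n" for i
    using *[OF that] by (elim imageE) simp
  have "?\<chi> = (\<Prod>i<n. [:- of_real (Re (as ! i)), 1:])"
    unfolding prod by (intro prod.cong refl) (simp add: re)
  moreover have "l \<le> Re (as ! i) \<and> Re (as ! i) \<le> r" if "i < n" for i
    using *[OF that] by (elim imageE) simp
  ultimately show ?thesis by (intro that[of "\<lambda>i. Re (as ! i)"])
qed

lemma cnj_block:
  assumes "\<And>i p q. i \<in> {1..k} \<Longrightarrow> p < n \<Longrightarrow> q < n \<Longrightarrow> cnj (A i $$ (p, q)) = A i $$ (q, p)"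
    and "s \<in> {..<n} \<rightarrow>\<^sub>E {1..k}" "p < n" "q < n"
  shows "cnj (block A s p q) = block A s q p"
proof -
  have "s p \<in> {1..k}" using assms(3) by (intro PiE_mem[OF assms(2)]) simp
  then show ?thesis using assms by (auto simp: block_def)
qed

text \<open>This is the absence of zeros of chi + t eta: \<open>mixed_det_nonzero\<close> with
  \<open>U\<close> empty, applied to z - A_i for i <> j and to z - A_j + t v v^* for the index j.
  Merging the parts cuts v down to part \<open>j\<close>.\<close>

lemma mixed_rank_one_nonzero:
  assumes j: "j \<in> {1..k}"
    and herm: "\<And>i p q. i \<in> {1..k} \<Longrightarrow> p < n \<Longrightarrow> q < n \<Longrightarrow> cnj (A i $$ (p, q)) = A i $$ (q, p)"
    and z: "Im z > 0" and t: "Im t \<ge> 0"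
  shows "(\<Sum>s\<in>{..<n} \<rightarrow>\<^sub>E {1..k}. pminor (\<lambda>p q. (if p = q then z else 0) - block A s p q
      + t * (restr j s v p * restr j s (\<lambda>p. cnj (v p)) q)) {..<n}) \<noteq> 0"
proof -
  define M where "M i p q = (if p = q then z else 0) - A i $$ (p, q)
    + (if i = j then t else 0) * (v p * cnj (v q))" for i p q
  note restr_def [simp]
  have "pos_im n (M i)" if "i \<in> {1..k}" for i
    unfolding M_def using that z t by (intro pos_im_shift herm) auto
  then have "(\<Sum>s\<in>{..<n} \<rightarrow>\<^sub>E {1..k}. \<Prod>i\<in>{1..k}. pminor (M i) ({p\<in>{..<n}. s p = i} \<union> {})) \<noteq> 0"
    using j by (intro mixed_det_nonzero) auto
  also have "(\<Sum>s\<in>{..<n} \<rightarrow>\<^sub>E {1..k}. \<Prod>i\<in>{1..k}. pminor (M i) ({p\<in>{..<n}. s p = i} \<union> {}))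
      = (\<Sum>s\<in>{..<n} \<rightarrow>\<^sub>E {1..k}. pminor (\<lambda>p q. (if p = q then z else 0) - block A s p q
      + t * (restr j s v p * restr j s (\<lambda>p. cnj (v p)) q)) {..<n})"
  proof (rule sum.cong[OF refl])
    fix s assume s: "s \<in> {..<n} \<rightarrow>\<^sub>E {1..k}"
    have "(\<Prod>i\<in>{1..k}. pminor (M i) ({p\<in>{..<n}. s p = i} \<union> {}))
        = pminor (\<lambda>p q. if s p = s q then M (s p) p q else 0) {..<n}"
      unfolding Un_empty_right using s by (intro prod_pminor_fibers) (auto dest: PiE_mem)
    also have "\<dots> = pminor (\<lambda>p q. (if p = q then z else 0) - block A s p q
      + t * (restr j s v p * restr j s (\<lambda>p. cnj (v p)) q)) {..<n}"
      by (rule pminor_cong) (auto simp: M_def block_def)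
    finally show "(\<Prod>i\<in>{1..k}. pminor (M i) ({p\<in>{..<n}. s p = i} \<union> {})) = \<dots>" .
  qed
  finally show ?thesis .
qed

section \<open>Roots of chi as nodes, and the weights and moments determined by a fixed
  vector\<close>

context
  fixes k n j :: nat and A :: "nat \<Rightarrow> complex mat" and v :: "nat \<Rightarrow> complex"
  assumes j: "j \<in> {1..k}"
    and carrier: "\<And>i. i \<in> {1..k} \<Longrightarrow> A i \<in> carrier_mat n n"
    and herm: "\<And>i p q. i \<in> {1..k} \<Longrightarrow> p < n \<Longrightarrow> q < n \<Longrightarrow> cnj (A i $$ (p, q)) = A i $$ (q, p)"
    and zd: "\<And>i p. i \<in> {1..k} \<Longrightarrow> p < n \<Longrightarrow> A i $$ (p, p) = 0"
begin

private abbreviation "assigns \<equiv> {..<n} \<rightarrow>\<^sub>E {1..k}"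
private abbreviation "u s \<equiv> restr j s v"
private abbreviation "u_cnj s \<equiv> restr j s (\<lambda>p. cnj (v p))"

text \<open>The quantity u^* adj (I - y B) u for the direct sum B of \<open>s\<close> and the
  component u of v in part \<open>j\<close>; up to powers of z it is the coefficient of t.\<close>

definition rank_one_num :: "(nat \<Rightarrow> nat) \<Rightarrow> complex poly" where
  "rank_one_num s = (\<Sum>p<n. \<Sum>q<n. smult (u_cnj s p * u s q) (rev_adj n (block A s) p q))"

definition total_den :: "complex poly" where
  "total_den = (\<Sum>s\<in>assigns. rev_char_poly n (block A s))"

text \<open>At y = 1 / x the quotient y \<open>total_num\<close> / \<open>total_den\<close> is eta /
  chi, and \<open>total_den\<close> is k^n y^n chi(1 / y).\<close>

definition total_num :: "complex poly" where
  "total_num = (\<Sum>s\<in>assigns. rank_one_num s)"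

lemma pminor_block_update:
  assumes s: "s \<in> assigns" and z: "Im z > 0"
  shows "pminor (\<lambda>p q. (if p = q then z else 0) - block A s p q + t * (u s p * u_cnj s q)) {..<n}
    = z ^ n * (poly (rev_char_poly n (block A s)) (1 / z) + t / z * poly (rank_one_num s) (1 / z))"
proof -
  have z0: "z \<noteq> 0" using z by auto
  \<comment> \<open>The rank-one formula requires det (I - y B) to be non-zero. This holds because z
    - B satisfies \<open>pos_im\<close>, seen from \<open>pos_im_shift\<close> with a vanishing
    rank-one term.\<close>
  have "pos_im n (\<lambda>p q. (if p = q then z else 0) - block A s p q + 0 * (0 * cnj 0))"
    using herm s by (intro pos_im_shift z cnj_block) auto
  then have "pminor (\<lambda>p q. (if p = q then z else 0) - block A s p q + 0 * (0 * 0)) {..<n} \<noteq> 0"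
    by (intro pminor_nonzero[of n]) simp_all
  then have nz: "poly (rev_char_poly n (block A s)) (1 / z) \<noteq> 0"
    unfolding pminor_shift_scale[OF z0] by (simp add: poly_rev_char_poly)
  show ?thesis
    unfolding pminor_shift_scale[OF z0] pminor_rank_one_update[OF nz]
    by (simp add: rank_one_num_def poly_sum sum_distrib_left mult_ac)
qed

lemma total_nonzero:
  assumes z: "Im z > 0" and t: "Im t \<ge> 0"
  shows "poly total_den (1 / z) + t / z * poly total_num (1 / z) \<noteq> 0"
proof -
  have "0 \<noteq> (\<Sum>s\<in>assigns. pminor (\<lambda>p q. (if p = q then z else 0) - block A s p q
      + t * (u s p * u_cnj s q)) {..<n})"
    using mixed_rank_one_nonzero[where A = A and v = v and n = n, OF j herm z t] by simp
  also have "(\<Sum>s\<in>assigns. pminor (\<lambda>p q. (if p = q then z else 0) - block A s p q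
      + t * (u s p * u_cnj s q)) {..<n})
    = (\<Sum>s\<in>assigns. z ^ n * (poly (rev_char_poly n (block A s)) (1 / z) + t / z * poly (rank_one_num s) (1 / z)))"
    by (intro sum.cong refl pminor_block_update z)
  also have "\<dots> = z ^ n * (poly total_den (1 / z) + t / z * poly total_num (1 / z))"
    by (simp only: total_den_def total_num_def poly_sum sum_distrib_left sum.distrib distrib_left)
  finally show ?thesis by auto
qed

lemma poly_mixed_det_poly_total:
  assumes z: "Im z > 0"
  shows "poly (mixed_det_poly k n A) z = z ^ n / of_nat k ^ n * poly total_den (1 / z)"
proof -
  have "poly (mixed_det_poly k n A) z
      = 1 / of_nat k ^ n * (\<Sum>s\<in>assigns. pminor (\<lambda>p q. (if p = q then z else 0) - block A s p q) {..<n})"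
    using carrier by (rule poly_mixed_det_poly)
  also have "(\<Sum>s\<in>assigns. pminor (\<lambda>p q. (if p = q then z else 0) - block A s p q) {..<n})
      = (\<Sum>s\<in>assigns. z ^ n * poly (rev_char_poly n (block A s)) (1 / z))"
    using pminor_block_update[OF _ z, of _ 0] by (intro sum.cong refl) simp
  finally show ?thesis by (simp add: total_den_def poly_sum sum_distrib_left)
qed

text \<open>This is eta. The dependence on t is affine, so the coefficient of t is the value at t =
  1 minus the value at t = 0. Differences of monic polynomials of degree \<open>n\<close> also show
  that its degree drops, as the partial fractions require.\<close>

definition rank_one_derivative :: "complex poly" where
  "rank_one_derivative = smult (1 / of_nat k ^ n) (\<Sum>s\<in>assigns.
    char_poly (mat n n (\<lambda>(p, q). block A s p q - u s p * u_cnj s q)) - char_poly (mat n n (\<lambda>(p, q). block A s p q)))"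

lemma poly_rank_one_derivative:
  assumes z: "Im z > 0"
  shows "poly rank_one_derivative z = z ^ n / of_nat k ^ n * (1 / z * poly total_num (1 / z))"
proof -
  have "poly (char_poly (mat n n (\<lambda>(p, q). block A s p q - u s p * u_cnj s q))
      - char_poly (mat n n (\<lambda>(p, q). block A s p q))) z = z ^ n * (1 / z * poly (rank_one_num s) (1 / z))"
    if s: "s \<in> assigns" for s
    using pminor_block_update[OF s z, of 1] pminor_block_update[OF s z, of 0]
    by (simp add: poly_char_poly_mat algebra_simps)
  then show ?thesis
    by (simp add: rank_one_derivative_def total_num_def poly_sum sum_distrib_left sum_divide_distrib)
qed

lemma degree_rank_one_derivative: "rank_one_derivative = 0 \<or> degree rank_one_derivative < n"
proof -
  have "degree rank_one_derivative \<le> n"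
    unfolding rank_one_derivative_def
    by (intro order.trans[OF degree_smult_le] degree_sum_le degree_diff_le finite_PiE)
      (auto simp: char_poly_mat_monic)
  moreover have "coeff rank_one_derivative n = 0"
    by (simp add: rank_one_derivative_def coeff_sum char_poly_mat_monic)
  ultimately show ?thesis
    by (metis leading_coeff_0_iff le_neq_implies_less)
qed

lemma block_trace: "s \<in> assigns \<Longrightarrow> (\<Sum>p<n. block A s p p) = 0"
  using PiE_mem[of s "{..<n}" "\<lambda>_. {1..k}"] zd by (simp add: block_def)

lemma rank_one_num_coeffs:
  assumes s: "s \<in> assigns"
  shows "coeff (rank_one_num s) 0 = (\<Sum>p<n. u_cnj s p * u s p)"
    and "coeff (rank_one_num s) (Suc 0) = (\<Sum>p<n. \<Sum>q<n. u_cnj s p * block A s p q * u s q)"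
    and "coeff (rank_one_num s) (Suc (Suc 0))
      = coeff (rev_char_poly n (block A s)) (Suc (Suc 0)) * (\<Sum>p<n. u_cnj s p * u s p)
        + (\<Sum>p<n. \<Sum>q<n. u_cnj s p * (\<Sum>r<n. block A s p r * block A s r q) * u s q)"
proof -
  note coeffs = rev_adj_coeffs[where n = n and B = "block A s", OF _ _ block_trace[OF s]]
  have delta: "(\<Sum>p<n. \<Sum>q<n. u_cnj s p * u s q * (if p = q then c else 0)) = c * (\<Sum>p<n. u_cnj s p * u s p)"
    for c :: complex
  proof -
    have "(\<Sum>q<n. u_cnj s p * u s q * (if p = q then c else 0)) = c * (u_cnj s p * u s p)"
      if "p \<in> {..<n}" for p
      using that by (simp add: if_distrib[of "\<lambda>x. _ * x"] cong: if_cong)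
    then show ?thesis by (simp add: sum_distrib_left)
  qed
  have "coeff (rank_one_num s) 0 = (\<Sum>p<n. \<Sum>q<n. u_cnj s p * u s q * (if p = q then 1 else 0))"
    unfolding rank_one_num_def coeff_sum coeff_smult by (intro sum.cong refl) (simp add: coeffs)
  then show "coeff (rank_one_num s) 0 = (\<Sum>p<n. u_cnj s p * u s p)" by (simp only: delta mult_1)
  show "coeff (rank_one_num s) (Suc 0) = (\<Sum>p<n. \<Sum>q<n. u_cnj s p * block A s p q * u s q)"
    unfolding rank_one_num_def coeff_sum coeff_smult by (intro sum.cong refl) (simp add: coeffs)
  have "coeff (rank_one_num s) (Suc (Suc 0))
      = (\<Sum>p<n. \<Sum>q<n. u_cnj s p * u s q * (if p = q then coeff (rev_char_poly n (block A s)) (Suc (Suc 0)) else 0)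
        + u_cnj s p * (\<Sum>r<n. block A s p r * block A s r q) * u s q)"
    unfolding rank_one_num_def coeff_sum coeff_smult by (intro sum.cong refl) (simp add: coeffs algebra_simps)
  then show "coeff (rank_one_num s) (Suc (Suc 0))
      = coeff (rev_char_poly n (block A s)) (Suc (Suc 0)) * (\<Sum>p<n. u_cnj s p * u s p)
        + (\<Sum>p<n. \<Sum>q<n. u_cnj s p * (\<Sum>r<n. block A s p r * block A s r q) * u s q)"
    by (simp only: sum.distrib delta)
qed

lemma mixed_det_poly_nodes:
  assumes roots: "all_roots_in (mixed_det_poly k n A) l r"
  obtains \<mu> w :: "nat \<Rightarrow> real"
  where "\<And>i. i < n \<Longrightarrow> l \<le> \<mu> i \<and> \<mu> i \<le> r" "\<And>i. i < n \<Longrightarrow> 0 \<le> w i"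
    and "total_den = smult (of_nat k ^ n) (\<Prod>i<n. [:1, - of_real (\<mu> i):])"
    and "total_num = smult (of_nat k ^ n) (\<Sum>i<n. smult (of_real (w i)) (\<Prod>l\<in>{..<n} - {i}. [:1, - of_real (\<mu> l):]))"
proof -
  let ?\<chi> = "mixed_det_poly k n A"
  have k: "k \<ge> 1" and k0: "of_nat k ^ n \<noteq> (0 :: complex)" using j by auto
  obtain \<mu> where \<mu>: "\<And>i. i < n \<Longrightarrow> l \<le> \<mu> i \<and> \<mu> i \<le> r"
    and \<chi>: "?\<chi> = (\<Prod>i<n. [:- of_real (\<mu> i), 1:])"
    by (rule mixed_det_poly_roots[where A = A and n = n and k = k, OF _ k roots], erule carrier, rule that)
  have "Im (poly rank_one_derivative z / (\<Prod>i<n. z - of_real (\<mu> i))) \<le> 0" if z: "Im z > 0" for z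
  proof (rule ccontr)
    assume *: "\<not> ?thesis"
    have z0: "z \<noteq> 0" using z by auto
    define f where "f = 1 / z * poly total_num (1 / z) / poly total_den (1 / z)"
    have den: "poly total_den (1 / z) \<noteq> 0" using total_nonzero[OF z, of 0] by simp
    have "(\<Prod>i<n. z - of_real (\<mu> i)) = poly ?\<chi> z" by (simp add: \<chi> poly_prod)
    then have "poly rank_one_derivative z / (\<Prod>i<n. z - of_real (\<mu> i)) = f"
      using z0 k0 den by (simp add: poly_mixed_det_poly_total[OF z] poly_rank_one_derivative[OF z] f_def)
    with * have f: "Im f > 0" by simp
    then have f0: "f \<noteq> 0" by auto
    \<comment> \<open>Here f is eta / chi at \<open>z\<close>. If Im f were positive, then t = -1 /
      f would lie in the upper half plane and chi + t eta would vanish at \<open>z\<close>.\<close>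
    have "Im (- 1 / f) = Im f / (cmod f)\<^sup>2"
      by (simp add: Im_divide cmod_power2)
    then have "Im (- 1 / f) \<ge> 0" using f by simp
    from total_nonzero[OF z this] show False
      using den f0 z0 by (simp add: f_def divide_simps)
  qed
  then have "\<exists>w. (\<forall>i\<in>{..<n}. 0 \<le> w i) \<and> rank_one_derivative
      = (\<Sum>i<n. smult (of_real (w i)) (\<Prod>l\<in>{..<n} - {i}. [:- of_real (\<mu> l), 1:]))"
    using degree_rank_one_derivative by (intro partial_fractions_nonneg) auto
  then obtain w where w: "\<And>i. i < n \<Longrightarrow> 0 \<le> w i"
    and num: "rank_one_derivative = (\<Sum>i<n. smult (of_real (w i)) (\<Prod>l\<in>{..<n} - {i}. [:- of_real (\<mu> l), 1:]))"
    by auto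
  have inv: "Im (1 / y) > 0" "y \<noteq> 0" if "Im y < 0" for y
  proof -
    show "y \<noteq> 0" using that by auto
    then have "(Re y)\<^sup>2 + (Im y)\<^sup>2 > 0" by (simp add: complex_neq_0)
    then show "Im (1 / y) > 0" using that by (simp add: Im_divide divide_neg_pos)
  qed
  have rev: "(\<Prod>i\<in>I. 1 / y - of_real (\<mu> i)) = (1 / y) ^ card I * (\<Prod>i\<in>I. 1 - y * of_real (\<mu> i))"
    if "y \<noteq> 0" for y :: complex and I :: "nat set"
  proof -
    have "(\<Prod>i\<in>I. 1 / y - of_real (\<mu> i)) = (\<Prod>i\<in>I. 1 / y * (1 - y * of_real (\<mu> i)))"
      using that by (intro prod.cong refl) (simp add: right_diff_distrib)
    then show ?thesis by (simp only: prod.distrib prod_constant)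
  qed
  \<comment> \<open>Both factorizations are carried from z to y = 1 / z, where each z - mu becomes
    (1 - y mu) / y. The products in the numerator have \<open>n - 1\<close> factors, and the missing
    power of y is the factor y between eta and \<open>total_num\<close>.\<close>
  have "total_den = smult (of_nat k ^ n) (\<Prod>i<n. [:1, - of_real (\<mu> i):])"
  proof (rule poly_eqI_lower_half_plane)
    fix y :: complex assume y: "Im y < 0"
    have "(1 / y) ^ n / of_nat k ^ n * poly total_den y = (1 / y) ^ n * (\<Prod>i<n. 1 - y * of_real (\<mu> i))"
      using poly_mixed_det_poly_total[OF inv(1)[OF y]] rev[OF inv(2)[OF y], of "{..<n}"]
      by (simp add: \<chi> poly_prod)
    then show "poly total_den y = poly (smult (of_nat k ^ n) (\<Prod>i<n. [:1, - of_real (\<mu> i):])) y"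
      using k0 inv(2)[OF y] by (simp add: poly_prod field_simps)
  qed
  moreover have "total_num = smult (of_nat k ^ n)
      (\<Sum>i<n. smult (of_real (w i)) (\<Prod>l\<in>{..<n} - {i}. [:1, - of_real (\<mu> l):]))"
  proof (rule poly_eqI_lower_half_plane)
    fix y :: complex assume y: "Im y < 0"
    note y0 = inv(2)[OF y]
    have "(1 / y) ^ n / of_nat k ^ n * (y * poly total_num y)
        = (\<Sum>i<n. of_real (w i) * (\<Prod>l\<in>{..<n} - {i}. 1 / y - of_real (\<mu> l)))"
      using poly_rank_one_derivative[OF inv(1)[OF y]]
      by (simp add: num poly_sum poly_prod)
    also have "\<dots> = (\<Sum>i<n. (1 / y) ^ n * y * (of_real (w i) * (\<Prod>l\<in>{..<n} - {i}. 1 - y * of_real (\<mu> l))))"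
    proof (intro sum.cong refl)
      fix i assume i: "i \<in> {..<n}"
      then have "Suc (card ({..<n} - {i})) = n" by simp
      then have "(1 / y) ^ n = 1 / y * (1 / y) ^ card ({..<n} - {i})" by (metis power_Suc)
      then have "(1 / y) ^ n * y = (1 / y) ^ card ({..<n} - {i})" using y0 by simp
      then show "of_real (w i) * (\<Prod>l\<in>{..<n} - {i}. 1 / y - of_real (\<mu> l))
          = (1 / y) ^ n * y * (of_real (w i) * (\<Prod>l\<in>{..<n} - {i}. 1 - y * of_real (\<mu> l)))"
        unfolding rev[OF y0] by (simp only: mult_ac)
    qed
    also have "\<dots> = (1 / y) ^ n * y * (\<Sum>i<n. of_real (w i) * (\<Prod>l\<in>{..<n} - {i}. 1 - y * of_real (\<mu> l)))"
      by (rule sum_distrib_left[symmetric])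
    finally have "poly total_num y
        = of_nat k ^ n * (\<Sum>i<n. of_real (w i) * (\<Prod>l\<in>{..<n} - {i}. 1 - y * of_real (\<mu> l)))"
      using k0 y0 by (simp add: field_simps)
    then show "poly total_num y = poly (smult (of_nat k ^ n)
        (\<Sum>i<n. smult (of_real (w i)) (\<Prod>l\<in>{..<n} - {i}. [:1, - of_real (\<mu> l):]))) y"
      by (simp add: poly_sum poly_prod)
  qed
  ultimately show thesis using \<mu> w that by blast
qed

text \<open>The weights \<open>w i\<close> at the roots \<open>\<mu> i\<close> form a measure whose first three moments are read off at
  infinity.\<close>

lemma mixed_moments:
  assumes den: "total_den = smult (of_nat k ^ n) (\<Prod>i<n. [:1, - of_real (\<mu> i):])"
    and num: "total_num = smult (of_nat k ^ n)
      (\<Sum>i<n. smult (of_real (w i)) (\<Prod>l\<in>{..<n} - {i}. [:1, - of_real (\<mu> l):]))"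
  shows "(\<Sum>i<n. complex_of_real (w i)) = (\<Sum>p<n. cnj (v p) * v p) / of_nat k"
    and "(\<Sum>i<n. complex_of_real (w i * \<mu> i)) = (\<Sum>p<n. \<Sum>q<n. cnj (v p) * A j $$ (p, q) * v q) / of_nat k ^ 2"
    and "(\<Sum>i<n. complex_of_real (w i * (\<mu> i)\<^sup>2))
      = ((\<Sum>p<n. \<Sum>q<n. cnj (v p) * (\<Sum>r<n. A j $$ (p, r) * A j $$ (r, q)) * v q)
        + (\<Sum>p<n. cnj (v p) * v p * (\<Sum>i\<in>{1..k} - {j}. \<Sum>q<n. A i $$ (p, q) * A i $$ (q, p)))) / of_nat k ^ 3"
proof -
  let ?F = "{..<n} \<rightarrow>\<^sub>E {1..k}"
  let ?N = "of_nat k ^ n :: complex"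
  let ?P = "\<Prod>i<n. [:1, - complex_of_real (\<mu> i):]"
  let ?V = "\<Sum>p<n. cnj (v p) * v p"
  let ?X = "\<Sum>p<n. \<Sum>q<n. cnj (v p) * A j $$ (p, q) * v q"
  let ?X2 = "\<Sum>p<n. \<Sum>q<n. cnj (v p) * (\<Sum>r<n. A j $$ (p, r) * A j $$ (r, q)) * v q"
  let ?d2 = "\<lambda>s. coeff (rev_char_poly n (block A s)) (Suc (Suc 0))"
  let ?uu = "\<lambda>s. \<Sum>p<n. restr j s (\<lambda>p. cnj (v p)) p * restr j s v p"
  let ?b = "\<lambda>i p. \<Sum>q<n. A i $$ (p, q) * A i $$ (q, p)"
  have N: "?N \<noteq> 0" and k: "complex_of_nat k \<noteq> 0" using j by auto
  have cancel: "a = b / c" if "?N * a = ?N / c * b" for a b c :: complex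
    using that mult_left_cancel[OF N, of a "b / c"] by simp
  \<comment> \<open>All direct sums are traceless, so the roots of chi sum to zero and the cross
    term in \<open>coeff_prod_one_minus_remove\<close> disappears.\<close>
  have P1: "coeff ?P (Suc 0) = 0"
  proof -
    have "coeff (total_den) (Suc 0) = 0"
      by (simp add: total_den_def coeff_sum rev_char_poly_coeffs block_trace)
    then show ?thesis using k by (auto simp: den)
  qed
  have P2: "?N * coeff ?P (Suc (Suc 0)) = (\<Sum>s\<in>?F. ?d2 s)"
    using arg_cong[OF den, of "\<lambda>f. coeff f (Suc (Suc 0))"]
    by (simp add: total_den_def coeff_sum)
  have fin: "finite {..<n}" by simp
  have R0: "coeff (\<Prod>l\<in>{..<n} - {i}. [:1, - complex_of_real (\<mu> l):]) 0 = 1" for i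
    by (intro coeff_prod_one_minus) simp
  have R1: "coeff (\<Prod>l\<in>{..<n} - {i}. [:1, - complex_of_real (\<mu> l):]) (Suc 0) = of_real (\<mu> i)"
    and R2: "coeff (\<Prod>l\<in>{..<n} - {i}. [:1, - complex_of_real (\<mu> l):]) (Suc (Suc 0))
      = coeff ?P (Suc (Suc 0)) + (of_real (\<mu> i))\<^sup>2" if "i \<in> {..<n}" for i
    using coeff_prod_one_minus_remove[OF fin that, of "\<lambda>l. of_real (\<mu> l)"] P1 by simp_all
  have total: "coeff (total_num) m = (\<Sum>s\<in>?F. coeff (rank_one_num s) m)" for m
    by (simp add: total_num_def coeff_sum)
  have "?N * (\<Sum>i<n. complex_of_real (w i)) = coeff (total_num) 0"
    unfolding num by (simp add: coeff_sum R0 del: coeff_0)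
  also have "\<dots> = (\<Sum>s\<in>?F. ?uu s)"
    unfolding total by (intro sum.cong refl rank_one_num_coeffs)
  also have "\<dots> = ?N / of_nat k * ?V"
    using j zd by (rule sum_moment0)
  finally show W0: "(\<Sum>i<n. complex_of_real (w i)) = ?V / of_nat k"
    by (rule cancel)
  have "?N * (\<Sum>i<n. complex_of_real (w i * \<mu> i)) = coeff (total_num) (Suc 0)"
    unfolding num by (simp add: coeff_sum R1)
  also have "\<dots> = (\<Sum>s\<in>?F. \<Sum>p<n. \<Sum>q<n. restr j s (\<lambda>p. cnj (v p)) p * block A s p q * restr j s v q)"
    unfolding total by (intro sum.cong refl rank_one_num_coeffs)
  also have "\<dots> = ?N / of_nat k ^ 2 * ?X"
    using j zd by (rule sum_moment1)
  finally show "(\<Sum>i<n. complex_of_real (w i * \<mu> i)) = ?X / of_nat k ^ 2"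
    by (rule cancel)
  have d2: "?d2 s = - (1 / 2) * (\<Sum>p<n. \<Sum>q<n. block A s p q * block A s q p)" if "s \<in> ?F" for s
    using rev_char_poly_coeffs(3)[of n "block A s"] block_trace[OF that] by (simp add: field_simps)
  have diff: "(\<Sum>s\<in>?F. ?d2 s * (?uu s - ?V / of_nat k)) = (\<Sum>s\<in>?F. ?d2 s * ?uu s) - (\<Sum>s\<in>?F. ?d2 s) * (?V / of_nat k)"
    by (simp only: right_diff_distrib sum_subtractf sum_distrib_right)
  have move: "a = (b - c) + e" if "a + c = b + e" for a b c e :: complex
    using that by (simp add: algebra_simps)
  \<comment> \<open>The second coefficient of the numerator mixes the second moment with the total
    weight times the second coefficient of chi. Since the total weight is
    \<open>?V / of_nat k\<close>, moving that term to the other side produces the covariance sum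
    \<open>diff\<close>.\<close>
  have "?N * (\<Sum>i<n. complex_of_real (w i * (\<mu> i)\<^sup>2)) + (\<Sum>s\<in>?F. ?d2 s) * (?V / of_nat k)
      = coeff (total_num) (Suc (Suc 0))"
  proof -
    have "coeff (total_num) (Suc (Suc 0))
        = ?N * (\<Sum>i<n. of_real (w i) * (coeff ?P (Suc (Suc 0)) + (of_real (\<mu> i))\<^sup>2))"
      unfolding num by (simp add: coeff_sum R2)
    also have "(\<Sum>i<n. of_real (w i) * (coeff ?P (Suc (Suc 0)) + (of_real (\<mu> i))\<^sup>2))
        = (\<Sum>i<n. coeff ?P (Suc (Suc 0)) * complex_of_real (w i) + complex_of_real (w i * (\<mu> i)\<^sup>2))"
      by (intro sum.cong refl) (simp add: algebra_simps)
    also have "\<dots> = coeff ?P (Suc (Suc 0)) * (\<Sum>i<n. complex_of_real (w i))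
        + (\<Sum>i<n. complex_of_real (w i * (\<mu> i)\<^sup>2))"
      by (simp only: sum.distrib sum_distrib_left)
    also have "?N * \<dots> = ?N * (\<Sum>i<n. complex_of_real (w i * (\<mu> i)\<^sup>2))
        + (?N * coeff ?P (Suc (Suc 0))) * (\<Sum>i<n. complex_of_real (w i))"
      by (simp only: distrib_left mult.assoc add.commute)
    finally show ?thesis by (simp only: P2 W0)
  qed
  also have "\<dots> = (\<Sum>s\<in>?F. ?d2 s * ?uu s)
      + (\<Sum>s\<in>?F. \<Sum>p<n. \<Sum>q<n. restr j s (\<lambda>p. cnj (v p)) p * (\<Sum>r<n. block A s p r * block A s r q) * restr j s v q)"
    unfolding total sum.distrib[symmetric] by (intro sum.cong refl rank_one_num_coeffs)
  finally have "?N * (\<Sum>i<n. complex_of_real (w i * (\<mu> i)\<^sup>2))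
      = (\<Sum>s\<in>?F. ?d2 s * (?uu s - ?V / of_nat k))
        + (\<Sum>s\<in>?F. \<Sum>p<n. \<Sum>q<n. restr j s (\<lambda>p. cnj (v p)) p * (\<Sum>r<n. block A s p r * block A s r q) * restr j s v q)"
    unfolding diff by (rule move)
  also have "(\<Sum>s\<in>?F. ?d2 s * (?uu s - ?V / of_nat k))
      = - (1 / 2) * (\<Sum>s\<in>?F. (\<Sum>p<n. \<Sum>q<n. block A s p q * block A s q p) * (?uu s - ?V / of_nat k))"
    unfolding sum_distrib_left by (intro sum.cong refl) (simp only: d2 mult.assoc)
  also have "\<dots> = - (?N / of_nat k ^ 3) * (\<Sum>p<n. cnj (v p) * v p * (of_nat k * ?b j p - (\<Sum>i\<in>{1..k}. ?b i p)))"
  proof -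
    have "(\<Sum>s\<in>?F. (\<Sum>p<n. \<Sum>q<n. block A s p q * block A s q p) * (?uu s - ?V / of_nat k))
        = 2 * (?N / of_nat k ^ 3) * (\<Sum>p<n. cnj (v p) * v p * (of_nat k * ?b j p - (\<Sum>i\<in>{1..k}. ?b i p)))"
      using j zd by (rule sum_moment2_cov)
    then show ?thesis by (simp only:) simp
  qed
  also have "(\<Sum>s\<in>?F. \<Sum>p<n. \<Sum>q<n. restr j s (\<lambda>p. cnj (v p)) p * (\<Sum>r<n. block A s p r * block A s r q) * restr j s v q)
      = ?N / of_nat k ^ 3 * (?X2 + (of_nat k - 1) * (\<Sum>p<n. cnj (v p) * v p * ?b j p))"
    using j zd by (rule sum_moment2_path)
  also have "- (?N / of_nat k ^ 3) * (\<Sum>p<n. cnj (v p) * v p * (of_nat k * ?b j p - (\<Sum>i\<in>{1..k}. ?b i p)))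
      + ?N / of_nat k ^ 3 * (?X2 + (of_nat k - 1) * (\<Sum>p<n. cnj (v p) * v p * ?b j p))
    = ?N / of_nat k ^ 3 * (?X2 + (\<Sum>p<n. cnj (v p) * v p * (\<Sum>i\<in>{1..k} - {j}. ?b i p)))"
  proof -
    \<comment> \<open>Writing b_i for the diagonal of A_i^2, (k - 1) b_j - (k b_j - sum of all b_i)
      is the sum of the b_i with i <> j.\<close>
    have "(\<Sum>p<n. cnj (v p) * v p * (\<Sum>i\<in>{1..k} - {j}. ?b i p))
        = (\<Sum>p<n. (of_nat k - 1) * (cnj (v p) * v p * ?b j p)
          - cnj (v p) * v p * (of_nat k * ?b j p - (\<Sum>i\<in>{1..k}. ?b i p)))"
    proof (intro sum.cong refl)
      fix p
      have "(\<Sum>i\<in>{1..k}. ?b i p) = ?b j p + (\<Sum>i\<in>{1..k} - {j}. ?b i p)"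
        using j by (intro sum.remove) auto
      then show "cnj (v p) * v p * (\<Sum>i\<in>{1..k} - {j}. ?b i p)
          = (of_nat k - 1) * (cnj (v p) * v p * ?b j p)
            - cnj (v p) * v p * (of_nat k * ?b j p - (\<Sum>i\<in>{1..k}. ?b i p))"
        by (simp only: algebra_simps mult_1)
    qed
    also have "\<dots> = (of_nat k - 1) * (\<Sum>p<n. cnj (v p) * v p * ?b j p)
        - (\<Sum>p<n. cnj (v p) * v p * (of_nat k * ?b j p - (\<Sum>i\<in>{1..k}. ?b i p)))"
      by (simp only: sum_subtractf sum_distrib_left)
    finally have E: "(\<Sum>p<n. cnj (v p) * v p * (\<Sum>i\<in>{1..k} - {j}. ?b i p))
        = (of_nat k - 1) * (\<Sum>p<n. cnj (v p) * v p * ?b j p)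
        - (\<Sum>p<n. cnj (v p) * v p * (of_nat k * ?b j p - (\<Sum>i\<in>{1..k}. ?b i p)))" .
    have "- M * c + M * (x + f) = M * (x + (f - c))" for M c x f :: complex
      by (simp add: algebra_simps)
    then show ?thesis unfolding E .
  qed
  finally show "(\<Sum>i<n. complex_of_real (w i * (\<mu> i)\<^sup>2))
      = (?X2 + (\<Sum>p<n. cnj (v p) * v p * (\<Sum>i\<in>{1..k} - {j}. ?b i p))) / of_nat k ^ 3"
    by (rule cancel)
qed

lemma mixed_quadratic_form_bound:
  assumes roots: "all_roots_in (mixed_det_poly k n A) l r"
  shows "Re (\<Sum>p<n. \<Sum>q<n. cnj (v p) * (\<Sum>r<n. A j $$ (p, r) * A j $$ (r, q)) * v q)
      + Re (\<Sum>p<n. cnj (v p) * v p * (\<Sum>i\<in>{1..k} - {j}. \<Sum>q<n. A i $$ (p, q) * A i $$ (q, p)))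
      \<le> real k * (l + r) * Re (\<Sum>p<n. \<Sum>q<n. cnj (v p) * A j $$ (p, q) * v q)
        - (real k)\<^sup>2 * (l * r) * Re (\<Sum>p<n. cnj (v p) * v p)"
proof -
  obtain \<mu> w where \<mu>: "\<And>i. i < n \<Longrightarrow> l \<le> \<mu> i \<and> \<mu> i \<le> r" and w: "\<And>i. i < n \<Longrightarrow> 0 \<le> w i"
    and den: "total_den = smult (of_nat k ^ n) (\<Prod>i<n. [:1, - of_real (\<mu> i):])"
    and num: "total_num = smult (of_nat k ^ n)
      (\<Sum>i<n. smult (of_real (w i)) (\<Prod>l\<in>{..<n} - {i}. [:1, - of_real (\<mu> l):]))"
    using mixed_det_poly_nodes[OF roots] by blast
  note moments = mixed_moments[OF den num, THEN arg_cong[where f = Re]]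
  have k: "real k > 0" using j by simp
  have "0 \<le> (\<Sum>i<n. w i * ((\<mu> i - l) * (r - \<mu> i)))"
    using \<mu> w by (intro sum_nonneg mult_nonneg_nonneg) auto
  also have "\<dots> = (l + r) * (\<Sum>i<n. w i * \<mu> i) - (\<Sum>i<n. w i * (\<mu> i)\<^sup>2) - l * r * (\<Sum>i<n. w i)"
    unfolding sum_distrib_left sum_subtractf[symmetric]
    by (intro sum.cong refl) (simp add: algebra_simps power2_eq_square)
  \<comment> \<open>The factor k^3 clears the denominators k, k^2 and k^3 of the three moments at
    once.\<close>
  finally have "0 \<le> real k ^ 3 * ((l + r) * (\<Sum>i<n. w i * \<mu> i) - (\<Sum>i<n. w i * (\<mu> i)\<^sup>2) - l * r * (\<Sum>i<n. w i))"
    using k by (intro mult_nonneg_nonneg) auto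
  also have "real k ^ 3 * ((l + r) * (\<Sum>i<n. w i * \<mu> i) - (\<Sum>i<n. w i * (\<mu> i)\<^sup>2) - l * r * (\<Sum>i<n. w i))
     = real k * (l + r) * (real k ^ 2 * (\<Sum>i<n. w i * \<mu> i)) - real k ^ 3 * (\<Sum>i<n. w i * (\<mu> i)\<^sup>2)
       - (real k)\<^sup>2 * (l * r) * (real k * (\<Sum>i<n. w i))"
    by (simp add: algebra_simps power2_eq_square power3_eq_cube)
  also have "real k * (\<Sum>i<n. w i) = Re (\<Sum>p<n. cnj (v p) * v p)"
    using moments(1) k by (simp add: field_simps)
  also have "real k ^ 2 * (\<Sum>i<n. w i * \<mu> i) = Re (\<Sum>p<n. \<Sum>q<n. cnj (v p) * A j $$ (p, q) * v q)"
    using moments(2) k by (simp add: field_simps flip: of_nat_power)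
  also have "real k ^ 3 * (\<Sum>i<n. w i * (\<mu> i)\<^sup>2)
     = Re (\<Sum>p<n. \<Sum>q<n. cnj (v p) * (\<Sum>r<n. A j $$ (p, r) * A j $$ (r, q)) * v q)
      + Re (\<Sum>p<n. cnj (v p) * v p * (\<Sum>i\<in>{1..k} - {j}. \<Sum>q<n. A i $$ (p, q) * A i $$ (q, p)))"
    using moments(3) k by (simp add: field_simps flip: of_nat_power)
  finally show ?thesis by linarith
qed

end

section \<open>The matrix inequality and its equality case\<close>

lemma hermitian_mat_iff:
  "hermitian_mat n A \<longleftrightarrow> A \<in> carrier_mat n n \<and> (\<forall>p<n. \<forall>q<n. cnj (A $$ (p, q)) = A $$ (q, p))"
proof (cases "A \<in> carrier_mat n n")
  case True
  then have dim: "mat_adjoint A \<in> carrier_mat n n" by (auto simp: mat_adjoint_def mat_of_rows_def)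
  have entry: "mat_adjoint A $$ (q, p) = cnj (A $$ (p, q))" if "p < n" "q < n" for p q
    using that True by (simp add: mat_adjoint_def mat_of_rows_index)
  have "mat_adjoint A = A \<longleftrightarrow> (\<forall>p<n. \<forall>q<n. cnj (A $$ (p, q)) = A $$ (q, p))"
  proof
    assume "mat_adjoint A = A"
    then show "\<forall>p<n. \<forall>q<n. cnj (A $$ (p, q)) = A $$ (q, p)" by (metis entry)
  next
    assume "\<forall>p<n. \<forall>q<n. cnj (A $$ (p, q)) = A $$ (q, p)"
    then show "mat_adjoint A = A" using True dim by (intro eq_matI) (simp_all add: entry)
  qed
  then show ?thesis using True by (simp add: hermitian_mat_def)
qed (simp add: hermitian_mat_def)

lemma square_mat_index:
  assumes "A \<in> carrier_mat n n" "p < n" "q < n"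
  shows "(A ^\<^sub>m 2) $$ (p, q) = (\<Sum>r<n. A $$ (p, r) * A $$ (r, q))"
  using assms by (simp add: numeral_2_eq_2 scalar_prod_def atLeast0LessThan)

lemma mult_mat_vec_cscalar_prod:
  assumes "D \<in> carrier_mat n n" "v \<in> carrier_vec n"
  shows "(D *\<^sub>v v) \<bullet>c v = (\<Sum>p<n. \<Sum>q<n. cnj (v $ p) * D $$ (p, q) * v $ q)"
  using assms by (simp add: scalar_prod_def atLeast0LessThan sum_distrib_left sum_distrib_right mult_ac)

text \<open>Completing the square: \<open>mixed_quadratic_form_bound\<close> bounds A_j^2 plus the
  diagonal terms by k (l + r) A_j - k^2 l r I. With c = k (l + r) / 2 the linear term is absorbed
  into (A_j - c I)^2, and c^2 - k^2 l r = k^2 (r - l)^2 / 4 is the constant on the right.\<close>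

lemma loewner_le_mixed:
  assumes j: "j \<in> {1..k}"
    and A: "\<And>i. i \<in> {1..k} \<Longrightarrow> hermitian_mat n (A i) \<and> zero_diagonal (A i)"
    and roots: "all_roots_in (mixed_det_poly k n A) l r"
  shows "loewner_le n
    ((A j - complex_of_real (real k * (l + r) / 2) \<cdot>\<^sub>m 1\<^sub>m n) ^\<^sub>m 2
      + mat_sum n (\<lambda>i. diag_part (A i ^\<^sub>m 2)) ({1..k} - {j}))
    (complex_of_real ((real k)\<^sup>2 * (r - l)\<^sup>2 / 4) \<cdot>\<^sub>m 1\<^sub>m n)" (is "loewner_le n ?M ?C")
proof -
  define c where "c = complex_of_real (real k * (l + r) / 2)"
  define D where "D = ?C - ?M"
  let ?sq = "\<lambda>i p q. \<Sum>r<n. A i $$ (p, r) * A i $$ (r, q)"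
  let ?\<delta> = "\<lambda>p q. if p = q then 1 else 0 :: complex"
  have carrier: "A i \<in> carrier_mat n n" if "i \<in> {1..k}" for i
    using A[OF that] by (simp add: hermitian_mat_def)
  have herm: "cnj (A i $$ (p, q)) = A i $$ (q, p)" if "i \<in> {1..k}" "p < n" "q < n" for i p q
    using A[OF that(1)] that by (simp add: hermitian_mat_iff)
  have zd: "A i $$ (p, p) = 0" if "i \<in> {1..k}" "p < n" for i p
    using A[OF that(1)] carrier[OF that(1)] that(2) by (auto simp: zero_diagonal_def)
  have dims: "?M \<in> carrier_mat n n" "?C \<in> carrier_mat n n" "D \<in> carrier_mat n n"
    using carrier[OF j] by (auto simp: D_def mat_sum_def intro!: minus_carrier_mat)
  have entry: "D $$ (p, q) = of_real (real k * (l + r)) * A j $$ (p, q) - ?sq j p q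
      - ?\<delta> p q * (of_real ((real k)\<^sup>2 * (l * r)) + (\<Sum>i\<in>{1..k} - {j}. ?sq i p q))"
    if pq: "p < n" "q < n" for p q
  proof -
    let ?B = "A j - c \<cdot>\<^sub>m 1\<^sub>m n"
    have B: "?B \<in> carrier_mat n n" using carrier[OF j] by auto
    have "(?B ^\<^sub>m 2) $$ (p, q) = (\<Sum>t<n. ?B $$ (p, t) * ?B $$ (t, q))"
      by (rule square_mat_index[OF B pq])
    also have "\<dots> = (\<Sum>t<n. A j $$ (p, t) * A j $$ (t, q) - (if t = p then c * A j $$ (p, q) else 0)
        - (if t = q then c * A j $$ (p, q) else 0) + (if t = p then c\<^sup>2 * ?\<delta> p q else 0))"
      using pq carrier[OF j] by (intro sum.cong refl) (auto simp: algebra_simps power2_eq_square)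
    also have "\<dots> = ?sq j p q - 2 * c * A j $$ (p, q) + c\<^sup>2 * ?\<delta> p q"
      using pq by (simp add: sum.distrib sum_subtractf)
    finally have sq: "(?B ^\<^sub>m 2) $$ (p, q) = ?sq j p q - 2 * c * A j $$ (p, q) + c\<^sup>2 * ?\<delta> p q" .
    have "diag_part (A i ^\<^sub>m 2) $$ (p, q) = ?\<delta> p q * ?sq i p q" if "i \<in> {1..k}" for i
      using square_mat_index[OF carrier[OF that] pq(2,2)] carrier[OF that] pq
      by (auto simp: diag_part_def mat_diag_def)
    then have diag: "mat_sum n (\<lambda>i. diag_part (A i ^\<^sub>m 2)) ({1..k} - {j}) $$ (p, q)
        = ?\<delta> p q * (\<Sum>i\<in>{1..k} - {j}. ?sq i p q)"
      using pq by (simp add: mat_sum_def sum_distrib_left)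
    have "D $$ (p, q) = of_real ((real k)\<^sup>2 * (r - l)\<^sup>2 / 4) * ?\<delta> p q
        - ((?B ^\<^sub>m 2) $$ (p, q) + mat_sum n (\<lambda>i. diag_part (A i ^\<^sub>m 2)) ({1..k} - {j}) $$ (p, q))"
      using pq B by (simp add: D_def c_def mat_sum_def)
    also have "of_real ((real k)\<^sup>2 * (r - l)\<^sup>2 / 4) = c\<^sup>2 - of_real ((real k)\<^sup>2 * (l * r))"
      unfolding c_def of_real_power[symmetric] of_real_diff[symmetric]
      by (intro arg_cong[of _ _ of_real]) (simp add: field_simps power2_eq_square)
    finally have "D $$ (p, q) = 2 * c * A j $$ (p, q) - ?sq j p q
      - ?\<delta> p q * (of_real ((real k)\<^sup>2 * (l * r)) + (\<Sum>i\<in>{1..k} - {j}. ?sq i p q))"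
      unfolding sq diag by (simp add: algebra_simps)
    moreover have "2 * c = of_real (real k * (l + r))" by (simp add: c_def)
    ultimately show ?thesis by (simp only:)
  qed
  have "hermitian_mat n D"
  proof -
    have csq: "cnj (?sq i p q) = ?sq i q p" if "i \<in> {1..k}" "p < n" "q < n" for i p q
      using that by (simp add: herm mult.commute)
    have "cnj (\<Sum>i\<in>{1..k} - {j}. ?sq i p p) = (\<Sum>i\<in>{1..k} - {j}. ?sq i p p)" if "p < n" for p
      unfolding cnj_sum[of _ "{1..k} - {j}"] using that by (intro sum.cong csq) auto
    then have "cnj (D $$ (p, q)) = D $$ (q, p)" if "p < n" "q < n" for p q
      using that csq[OF j that] herm[OF j that] by (cases "p = q") (simp_all add: entry)
    then show ?thesis using dims by (simp add: hermitian_mat_iff)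
  qed
  moreover have "0 \<le> Re ((D *\<^sub>v v) \<bullet>c v)" if v: "v \<in> carrier_vec n" for v
  proof -
    have "(D *\<^sub>v v) \<bullet>c v = (\<Sum>p<n. \<Sum>q<n. cnj (v $ p) * D $$ (p, q) * v $ q)"
      by (rule mult_mat_vec_cscalar_prod[OF dims(3) v])
    also have "\<dots> = (\<Sum>p<n. \<Sum>q<n. of_real (real k * (l + r)) * (cnj (v $ p) * A j $$ (p, q) * v $ q)
        - cnj (v $ p) * ?sq j p q * v $ q
        - (if p = q then of_real ((real k)\<^sup>2 * (l * r)) * (cnj (v $ p) * v $ p)
            + cnj (v $ p) * v $ p * (\<Sum>i\<in>{1..k} - {j}. ?sq i p p) else 0))"
      by (rule sum.cong[OF refl], rule sum.cong[OF refl]) (simp add: entry algebra_simps)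
    also have "\<dots> = of_real (real k * (l + r)) * (\<Sum>p<n. \<Sum>q<n. cnj (v $ p) * A j $$ (p, q) * v $ q)
        - (\<Sum>p<n. \<Sum>q<n. cnj (v $ p) * ?sq j p q * v $ q)
        - (of_real ((real k)\<^sup>2 * (l * r)) * (\<Sum>p<n. cnj (v $ p) * v $ p)
          + (\<Sum>p<n. cnj (v $ p) * v $ p * (\<Sum>i\<in>{1..k} - {j}. ?sq i p p)))"
    proof -
      have delta: "(\<Sum>p<n. \<Sum>q<n. if p = q then g p else 0) = (\<Sum>p<n. g p)" for g :: "nat \<Rightarrow> complex"
        by simp
      show ?thesis unfolding sum_subtractf delta sum.distrib sum_distrib_left[symmetric] ..
    qed
    finally show ?thesis
      using mixed_quadratic_form_bound[where A = A and v = "($) v", OF j carrier herm zd roots]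
      by simp
  qed
  ultimately show ?thesis using dims by (simp add: loewner_le_def psd_mat_def D_def)
qed

section \<open>The equality case, with one 2 by 2 matrix repeated \<open>k\<close> times\<close>

lemma pminor_two: "pminor M {..<2} = M 0 0 * M 1 1 - M 0 1 * M 1 (0 :: nat)"
proof -
  have "{..<2} = insert 1 (insert (0 :: nat) {})" by (auto simp: numeral_2_eq_2)
  moreover have "pminor M (insert 1 (insert 0 {})) = M 0 0 * M 1 1 - M 0 1 * M 1 (0 :: nat)"
    unfolding pminor_def
    by (subst sum_over_permutations_insert)
      (simp_all add: sum_over_permutations_insert sign_swap_id transpose_def)
  ultimately show ?thesis by simp
qed

text \<open>Its square is the identity and equals its own diagonal part, so with all A_i equal to it
  the left-hand side is k I for every j.\<close>

definition flip_mat :: "complex mat" where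
  "flip_mat = mat 2 2 (\<lambda>(p, q). if p = q then 0 else 1)"

text \<open>The two indices share a part with probability 1 / k, and then the determinant is z^2 -
  1; otherwise it is z^2.\<close>

lemma poly_mixed_det_poly_flip_mat:
  assumes k: "k \<ge> 1"
  shows "poly (mixed_det_poly k 2 (\<lambda>_. flip_mat)) z = z\<^sup>2 - 1 / of_nat k"
proof -
  let ?F = "{..<2 :: nat} \<rightarrow>\<^sub>E {1..k}"
  have "poly (mixed_det_poly k 2 (\<lambda>_. flip_mat)) z = 1 / of_nat k ^ 2 *
      (\<Sum>s\<in>?F. pminor (\<lambda>p q. (if p = q then z else 0) - block (\<lambda>_. flip_mat) s p q) {..<2})"
    by (rule poly_mixed_det_poly) (simp add: flip_mat_def)
  also have "(\<Sum>s\<in>?F. pminor (\<lambda>p q. (if p = q then z else 0) - block (\<lambda>_. flip_mat) s p q) {..<2})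
      = (\<Sum>s\<in>?F. z\<^sup>2 - (\<Sum>i\<in>{1..k}. if s 0 = i \<and> s 1 = i then 1 else 0))"
  proof (rule sum.cong[OF refl])
    fix s assume s: "s \<in> ?F"
    have "s 0 \<in> {1..k}" by (rule PiE_mem[OF s]) simp
    then have "(\<Sum>i\<in>{1..k}. if s 0 = i \<and> s 1 = i then 1 else 0 :: complex)
        = (\<Sum>i\<in>{s 0}. if s 0 = i \<and> s 1 = i then 1 else 0)"
      by (intro sum.mono_neutral_right) auto
    then show "pminor (\<lambda>p q. (if p = q then z else 0) - block (\<lambda>_. flip_mat) s p q) {..<2}
        = z\<^sup>2 - (\<Sum>i\<in>{1..k}. if s 0 = i \<and> s 1 = i then 1 else 0)"
      by (simp add: pminor_two block_def flip_mat_def power2_eq_square)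
  qed
  also have "\<dots> = of_nat (k ^ 2) * z\<^sup>2 - (\<Sum>i\<in>{1..k}. \<Sum>s\<in>?F. if s 0 = i \<and> s 1 = i then 1 else 0)"
    unfolding sum_subtractf sum.swap[of _ "{1..k}"] by (simp only: sum_constant card_assignments)
  also have "(\<Sum>i\<in>{1..k}. \<Sum>s\<in>?F. if s 0 = i \<and> s 1 = i then 1 else 0) = (\<Sum>i\<in>{1..k}. 1 :: complex)"
    using k by (intro sum.cong refl, subst count_assignments2) auto
  also have "1 / of_nat k ^ 2 * (of_nat (k ^ 2) * z\<^sup>2 - (\<Sum>i\<in>{1..k}. 1)) = z\<^sup>2 - 1 / of_nat k"
    using k by (simp add: field_simps power2_eq_square)
  finally show ?thesis .
qed

lemma flip_mat_square: "flip_mat ^\<^sub>m 2 = 1\<^sub>m 2"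
proof (rule eq_matI)
  fix p q assume "p < dim_row (1\<^sub>m 2 :: complex mat)" "q < dim_col (1\<^sub>m 2 :: complex mat)"
  then have pq: "p < 2" "q < 2" by auto
  have "(flip_mat ^\<^sub>m 2) $$ (p, q) = (\<Sum>r<2. flip_mat $$ (p, r) * flip_mat $$ (r, q))"
    by (rule square_mat_index[OF _ pq]) (simp add: flip_mat_def)
  then show "(flip_mat ^\<^sub>m 2) $$ (p, q) = 1\<^sub>m 2 $$ (p, q)"
    using pq by (auto simp: flip_mat_def numeral_2_eq_2 less_Suc_eq)
qed (simp_all add: flip_mat_def)

text \<open>The value of \<open>R\<close> is the positive root of z^2 - 1 / k; it turns k^2 R^2 into
  k, which is one identity from the square of A_j plus \<open>k - 1\<close> from the other diagonal
  parts.\<close>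

lemma mixed_bound_attained:
  fixes k :: nat
  assumes k: "k \<ge> 1"
  defines "R \<equiv> 1 / sqrt (real k)"
  shows "hermitian_mat 2 flip_mat" "zero_diagonal flip_mat"
    and "all_roots_in (mixed_det_poly k 2 (\<lambda>_. flip_mat)) (- R) R"
    and "j \<in> {1..k} \<Longrightarrow> flip_mat ^\<^sub>m 2 + mat_sum 2 (\<lambda>i. diag_part (flip_mat ^\<^sub>m 2)) ({1..k} - {j})
      = complex_of_real ((real k)\<^sup>2 * R\<^sup>2) \<cdot>\<^sub>m 1\<^sub>m 2"
proof -
  show "hermitian_mat 2 flip_mat" by (simp add: hermitian_mat_iff flip_mat_def)
  show "zero_diagonal flip_mat" by (simp add: zero_diagonal_def flip_mat_def)
  have R: "R\<^sup>2 = 1 / real k" "R \<ge> 0" by (simp_all add: R_def power_divide)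
  show "all_roots_in (mixed_det_poly k 2 (\<lambda>_. flip_mat)) (- R) R"
    unfolding all_roots_in_def
  proof (intro allI impI)
    fix z assume "poly (mixed_det_poly k 2 (\<lambda>_. flip_mat)) z = 0"
    then have "z\<^sup>2 = of_real (R\<^sup>2)" by (simp add: poly_mixed_det_poly_flip_mat[OF k] R)
    then have "z = of_real R \<or> z = of_real (- R)" by (simp add: power2_eq_iff)
    then show "z \<in> complex_of_real ` {- R..R}" using R(2) by auto
  qed
  assume j: "j \<in> {1..k}"
  have "diag_part (1\<^sub>m 2) $$ (p, q) = (1\<^sub>m 2 $$ (p, q) :: complex)" if "p < 2" "q < 2" for p q
    using that by (simp add: diag_part_def mat_diag_def)
  then have "mat_sum 2 (\<lambda>i. diag_part (1\<^sub>m 2)) ({1..k} - {j}) = (of_nat k - 1) \<cdot>\<^sub>m 1\<^sub>m 2"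
    using j by (intro eq_matI) (auto simp: mat_sum_def of_nat_diff)
  moreover have "(real k)\<^sup>2 * R\<^sup>2 = real k" using k unfolding R(1) by (simp add: power2_eq_square)
  ultimately show "flip_mat ^\<^sub>m 2 + mat_sum 2 (\<lambda>i. diag_part (flip_mat ^\<^sub>m 2)) ({1..k} - {j})
      = complex_of_real ((real k)\<^sup>2 * R\<^sup>2) \<cdot>\<^sub>m 1\<^sub>m 2"
    unfolding flip_mat_square by (intro eq_matI) auto
qed

theorem theorem1p5:
  fixes k :: nat
  assumes "k \<ge> 1"
  shows
    "(\<forall>(n::nat) (A :: nat \<Rightarrow> complex mat).
        (\<forall>i\<in>{1..k}. hermitian_mat n (A i) \<and> zero_diagonal (A i)) \<longrightarrow>
          (\<forall>(l::real) (r::real). all_roots_in (mixed_det_poly k n A) l r \<longrightarrow>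
             (\<forall>j\<in>{1..k}.
                loewner_le n
                  ((A j - complex_of_real (real k * (l + r) / 2) \<cdot>\<^sub>m 1\<^sub>m n) ^\<^sub>m 2
                     + mat_sum n (\<lambda>i. diag_part (A i ^\<^sub>m 2)) ({1..k} - {j}))
                  (complex_of_real ((real k)^2 * (r - l)^2 / 4) \<cdot>\<^sub>m 1\<^sub>m n))) \<and>
          (\<forall>(R::real). all_roots_in (mixed_det_poly k n A) (- R) R \<longrightarrow>
             (\<forall>j\<in>{1..k}.
                loewner_le n
                  (A j ^\<^sub>m 2 + mat_sum n (\<lambda>i. diag_part (A i ^\<^sub>m 2)) ({1..k} - {j}))
                  (complex_of_real ((real k)^2 * R^2) \<cdot>\<^sub>m 1\<^sub>m n)))) \<and>
     (\<exists>(n::nat) (A :: nat \<Rightarrow> complex mat) (R::real).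
        n \<ge> 1 \<and>
        (\<forall>i\<in>{1..k}. hermitian_mat n (A i) \<and> zero_diagonal (A i)) \<and>
        all_roots_in (mixed_det_poly k n A) (- R) R \<and>
        (\<forall>j\<in>{1..k}.
           A j ^\<^sub>m 2 + mat_sum n (\<lambda>i. diag_part (A i ^\<^sub>m 2)) ({1..k} - {j})
             = complex_of_real ((real k)^2 * R^2) \<cdot>\<^sub>m 1\<^sub>m n))"
proof (intro conjI allI impI ballI)
  fix n A l r j
  assume A: "\<forall>i\<in>{1..k}. hermitian_mat n (A i) \<and> zero_diagonal (A i)"
    and roots: "all_roots_in (mixed_det_poly k n A) l r" and j: "j \<in> {1..k}"
  show "loewner_le n
      ((A j - complex_of_real (real k * (l + r) / 2) \<cdot>\<^sub>m 1\<^sub>m n) ^\<^sub>m 2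
        + mat_sum n (\<lambda>i. diag_part (A i ^\<^sub>m 2)) ({1..k} - {j}))
      (complex_of_real ((real k)^2 * (r - l)^2 / 4) \<cdot>\<^sub>m 1\<^sub>m n)"
    using loewner_le_mixed[OF j bspec[OF A] roots] by simp
next
  fix n A R j
  assume A: "\<forall>i\<in>{1..k}. hermitian_mat n (A i) \<and> zero_diagonal (A i)"
    and roots: "all_roots_in (mixed_det_poly k n A) (- R) R" and j: "j \<in> {1..k}"
  have "A j \<in> carrier_mat n n" using A j by (simp add: hermitian_mat_def)
  then have "A j - complex_of_real (real k * (- R + R) / 2) \<cdot>\<^sub>m 1\<^sub>m n = A j"
    by (intro eq_matI) auto
  moreover have "(real k)\<^sup>2 * (R - - R)\<^sup>2 / 4 = (real k)\<^sup>2 * R\<^sup>2"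
    by (simp add: power2_eq_square)
  ultimately show "loewner_le n
      (A j ^\<^sub>m 2 + mat_sum n (\<lambda>i. diag_part (A i ^\<^sub>m 2)) ({1..k} - {j}))
      (complex_of_real ((real k)^2 * R^2) \<cdot>\<^sub>m 1\<^sub>m n)"
    using loewner_le_mixed[OF j bspec[OF A] roots] by simp
next
  show "\<exists>(n::nat) (A :: nat \<Rightarrow> complex mat) (R::real).
      n \<ge> 1 \<and>
      (\<forall>i\<in>{1..k}. hermitian_mat n (A i) \<and> zero_diagonal (A i)) \<and>
      all_roots_in (mixed_det_poly k n A) (- R) R \<and>
      (\<forall>j\<in>{1..k}.
         A j ^\<^sub>m 2 + mat_sum n (\<lambda>i. diag_part (A i ^\<^sub>m 2)) ({1..k} - {j})
           = complex_of_real ((real k)^2 * R^2) \<cdot>\<^sub>m 1\<^sub>m n)"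
    using mixed_bound_attained[OF assms]
    by (intro exI[of _ 2] exI[of _ "\<lambda>_. flip_mat"] exI[of _ "1 / sqrt (real k)"] conjI ballI) auto
qed

end
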